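(* Let $K,L\ge 0$ be integers, let $n=K+L+1$, and let $\mu=(K+1,1^L)$. Then the family $\{\partial_D\Delta_{\mu}\}_{D\in{\cal D}}$ spans the vector space $M_{\mu}$.
   Context: Polynomials are in the variables $x_1,\dots,x_n,y_1,\dots,y_n$ with coefficients in $\mathbb{Q}$. Here $\mu=(K+1,1^L)$ is the hook-shaped partition of $n=K+L+1$ with one part $K+1$ and $L$ parts $1$. Its biexponents are the pairs $(0,0),(0,1),\dots,(0,K),(1,0),\dots,(L,0)$, listed in lexicographic order as $(p_1,q_1),\dots,(p_n,q_n)$, and $$\Delta_\mu(x,y)=\det\big(x_i^{p_j}y_i^{q_j}\big)_{i,j=1,\dots,n}.$$ $M_\mu$ is the linear span of all partial derivatives (of all orders, including order $0$) of $\Delta_\mu$ with respect to the variables $x_i,y_i$. Drawings with crosses (the set ${\cal D}$). There are $n-1=K+L$ places numbered $1,\dots,n-1$ from left to right along an axis. A drawing puts at each place one column: $K$ of the places carry a $y$-column (above the axis) and the other $L$ places carry an $x$-column (below the axis), the two types being interleaved in any way. From left to right the $y$-columns have heights $K,K-1,\dots,1$ and the $x$-columns have depths $L,L-1,\dots,1$ (a column of height or depth $h$ consists of $h$ cells). Each cell either contains a cross or is white; only the number of crosses in each column matters, i.e. two drawings with the same columns and the same number of crosses in each column are identified. The numbers of crosses are subject to: (1) in an $x$-column the number of crosses is arbitrary (between $0$ and its depth); (2) for a $y$-column with no $x$-column to its right, the number of crosses is arbitrary (between $0$ and its height). For a $y$-column having an $x$-column to its right, consider the first (nearest) $x$-column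 to its right which is uniform, meaning all its cells are crossed or all its cells are white (it exists, since the $x$-column of depth $1$ is uniform): if that $x$-column is all white, the $y$-column must contain at least one cross; if it is all crossed, the $y$-column must contain at least one white cell. ${\cal D}$ is the set of all drawings with crosses satisfying these rules. For $D\in{\cal D}$, $\partial_D=\prod_i \partial_{x_i}^{a_i}\prod_j\partial_{y_j}^{b_j}$, where $i$ runs over the places carrying an $x$-column with $a_i$ crosses and $j$ over the places carrying a $y$-column with $b_j$ crosses. *)

theory Defs
  imports "HOL-Library.Poly_Mapping" "Jordan_Normal_Form.Determinant"
begin

text \<open>Multivariate polynomials over the rationals are finitely supported maps from monomials
  (exponent vectors) to coefficients; the ring structure is the convolution product of
  \<^theory>\<open>HOL-Library.Poly_Mapping\<close>. The variables of interest are \<open>X 1, \<dots>, X n, Y 1, \<dots>, Y n\<close>.\<close>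

datatype var = X nat | Y nat

type_synonym monomial = "var \<Rightarrow>\<^sub>0 nat"
type_synonym poly_xy = "monomial \<Rightarrow>\<^sub>0 rat"

definition Var :: "var \<Rightarrow> poly_xy" where
  "Var v = Poly_Mapping.single (Poly_Mapping.single v 1) 1"

definition Const :: "rat \<Rightarrow> poly_xy" where
  "Const c = Poly_Mapping.single 0 c"

definition scale_poly :: "rat \<Rightarrow> poly_xy \<Rightarrow> poly_xy" where
  "scale_poly c p = Const c * p"

global_interpretation poly_xy: vector_space scale_poly
proof
  fix a b :: rat and x y :: poly_xy
  show "scale_poly a (x + y) = scale_poly a x + scale_poly a y"
    by (simp add: scale_poly_def distrib_left)
  show "scale_poly (a + b) x = scale_poly a x + scale_poly b x"
    by (simp add: scale_poly_def Const_def single_add distrib_right)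
  show "scale_poly a (scale_poly b x) = scale_poly (a * b) x"
    by (simp add: scale_poly_def Const_def mult_single flip: mult.assoc)
  show "scale_poly 1 x = x"
    by (simp add: scale_poly_def Const_def)
qed

definition pderiv_var :: "var \<Rightarrow> poly_xy \<Rightarrow> poly_xy" where
  "pderiv_var v p = (\<Sum>m\<in>Poly_Mapping.keys p.
     Poly_Mapping.single (m - Poly_Mapping.single v 1)
       (of_nat (Poly_Mapping.lookup m v) * Poly_Mapping.lookup p m))"

definition pderivs :: "var list \<Rightarrow> poly_xy \<Rightarrow> poly_xy" where
  "pderivs vs = foldr pderiv_var vs"

lemma lookup_pderiv_var:
  "Poly_Mapping.lookup (pderiv_var v p) m =
     of_nat (Poly_Mapping.lookup m v + 1) * Poly_Mapping.lookup p (m + Poly_Mapping.single v 1)"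
proof -
  let ?e = "Poly_Mapping.single v (1::nat)"
  have eq: "(k - ?e = m \<and> Poly_Mapping.lookup k v \<noteq> 0) \<longleftrightarrow> k = m + ?e" for k
  proof
    assume a: "k - ?e = m \<and> Poly_Mapping.lookup k v \<noteq> 0"
    show "k = m + ?e"
    proof (rule poly_mapping_eqI)
      fix w show "Poly_Mapping.lookup k w = Poly_Mapping.lookup (m + ?e) w"
        using a by (auto simp: lookup_add lookup_minus lookup_single when_def)
    qed
  qed (simp add: lookup_add)
  have "Poly_Mapping.lookup (pderiv_var v p) m =
      (\<Sum>k\<in>Poly_Mapping.keys p.
        if k - ?e = m then of_nat (Poly_Mapping.lookup k v) * Poly_Mapping.lookup p k else 0)"
    by (simp add: pderiv_var_def lookup_sum lookup_single when_def)
  also have "\<dots> = (\<Sum>k\<in>Poly_Mapping.keys p.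
        if k = m + ?e then of_nat (Poly_Mapping.lookup k v) * Poly_Mapping.lookup p k else 0)"
  proof (rule sum.cong)
    fix k
    show "(if k - ?e = m then of_nat (Poly_Mapping.lookup k v) * Poly_Mapping.lookup p k else 0) =
        (if k = m + ?e then of_nat (Poly_Mapping.lookup k v) * Poly_Mapping.lookup p k else 0)"
      using eq[of k] by (cases "Poly_Mapping.lookup k v = 0") simp_all
  qed simp
  also have "\<dots> = of_nat (Poly_Mapping.lookup m v + 1) * Poly_Mapping.lookup p (m + ?e)"
    by (simp add: in_keys_iff lookup_add)
  finally show ?thesis .
qed

lemma pderiv_var_commute: "pderiv_var v (pderiv_var w p) = pderiv_var w (pderiv_var v p)"
proof (cases "v = w")
  case False
  show ?thesis
  proof (rule poly_mapping_eqI)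
    fix m
    let ?v = "Poly_Mapping.single v (1::nat)" and ?w = "Poly_Mapping.single w (1::nat)"
    have "m + ?v + ?w = m + ?w + ?v"
      by (simp only: add.assoc add.commute[of ?v ?w])
    moreover have "Poly_Mapping.lookup (m + ?v) w = Poly_Mapping.lookup m w"
      and "Poly_Mapping.lookup (m + ?w) v = Poly_Mapping.lookup m v"
      using False by (simp_all add: lookup_add lookup_single_not_eq)
    ultimately show "Poly_Mapping.lookup (pderiv_var v (pderiv_var w p)) m =
        Poly_Mapping.lookup (pderiv_var w (pderiv_var v p)) m"
      unfolding lookup_pderiv_var by (simp only: mult.left_commute)
  qed
qed simp

text \<open>A partition is a list of its parts. The biexponents are the cells of its diagram, row by row,
  which is the lexicographic order.\<close>

definition hook :: "nat \<Rightarrow> nat \<Rightarrow> nat list" where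
  "hook K L = (K + 1) # replicate L 1"

definition biexponents :: "nat list \<Rightarrow> (nat \<times> nat) list" where
  "biexponents \<mu> = concat (map (\<lambda>p. map (\<lambda>q. (p, q)) [0..<\<mu> ! p]) [0..<length \<mu>])"

lemma sum_list_hook: "sum_list (hook K L) = K + L + 1"
  by (simp add: hook_def sum_list_replicate)

lemma biexponents_hook:
  "biexponents (hook K L) = map (\<lambda>q. (0, q)) [0..<K + 1] @ map (\<lambda>p. (p, 0)) [1..<L + 1]"
proof -
  let ?row = "\<lambda>p. map (\<lambda>q. (p, q)) [0..<hook K L ! p]"
  have rows: "map ?row [1..<L + 1] = map (\<lambda>p. [(p, 0)]) [1..<L + 1]"
    by (rule map_cong) (auto simp: hook_def nth_Cons')
  have rows_upt: "[0..<length (hook K L)] = 0 # [1..<L + 1]"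
    by (simp add: hook_def upt_conv_Cons del: upt_Suc)
  have singletons: "concat (map (\<lambda>p. [(p, 0)]) xs) = map (\<lambda>p. (p, 0::nat)) xs" for xs :: "nat list"
    by (induction xs) auto
  have "biexponents (hook K L) = ?row 0 @ concat (map ?row [1..<L + 1])"
    unfolding biexponents_def rows_upt by simp
  also have "?row 0 = map (\<lambda>q. (0, q)) [0..<K + 1]"
    by (simp add: hook_def)
  finally show ?thesis
    unfolding rows singletons .
qed

text \<open>Matrix indices start at 0, indices of variables at 1.\<close>

definition Delta :: "nat list \<Rightarrow> poly_xy" where
  "Delta \<mu> = (let n = sum_list \<mu> in det (mat n n (\<lambda>(i, j).
     case biexponents \<mu> ! j of (p, q) \<Rightarrow> Var (X (Suc i)) ^ p * Var (Y (Suc i)) ^ q)))"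

definition vars :: "nat \<Rightarrow> var set" where
  "vars n = X ` {1..n} \<union> Y ` {1..n}"

definition M :: "nat list \<Rightarrow> poly_xy set" where
  "M \<mu> = poly_xy.span {pderivs vs (Delta \<mu>) | vs. set vs \<subseteq> vars (sum_list \<mu>)}"

text \<open>A drawing is the list of its columns from left to right, each given by its type and its number
  of crosses. List position \<open>i\<close> is place \<open>i + 1\<close>.\<close>

datatype coltype = XCol | YCol

type_synonym drawing = "(coltype \<times> nat) list"

abbreviation kind :: "drawing \<Rightarrow> nat \<Rightarrow> coltype" where
  "kind D i \<equiv> fst (D ! i)"

abbreviation crosses :: "drawing \<Rightarrow> nat \<Rightarrow> nat" where
  "crosses D i \<equiv> snd (D ! i)"

definition height :: "nat \<Rightarrow> nat \<Rightarrow> drawing \<Rightarrow> nat \<Rightarrow> nat" where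
  "height K L D i =
     (case kind D i of YCol \<Rightarrow> K | XCol \<Rightarrow> L) - card {j. j < i \<and> kind D j = kind D i}"

definition white_xcol :: "drawing \<Rightarrow> nat \<Rightarrow> bool" where
  "white_xcol D j \<longleftrightarrow> kind D j = XCol \<and> crosses D j = 0"

definition crossed_xcol :: "nat \<Rightarrow> nat \<Rightarrow> drawing \<Rightarrow> nat \<Rightarrow> bool" where
  "crossed_xcol K L D j \<longleftrightarrow> kind D j = XCol \<and> crosses D j = height K L D j"

definition uniform_xcol :: "nat \<Rightarrow> nat \<Rightarrow> drawing \<Rightarrow> nat \<Rightarrow> bool" where
  "uniform_xcol K L D j \<longleftrightarrow> white_xcol D j \<or> crossed_xcol K L D j"

definition first_uniform_right :: "nat \<Rightarrow> nat \<Rightarrow> drawing \<Rightarrow> nat \<Rightarrow> nat \<Rightarrow> bool" where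
  "first_uniform_right K L D i j \<longleftrightarrow>
     i < j \<and> j < length D \<and> uniform_xcol K L D j \<and> (\<forall>k. i < k \<and> k < j \<longrightarrow> \<not> uniform_xcol K L D k)"

text \<open>The last condition is vacuous for a \<open>y\<close>-column without an \<open>x\<close>-column to its right.\<close>

definition drawings :: "nat \<Rightarrow> nat \<Rightarrow> drawing set" where
  "drawings K L = {D.
     length D = K + L \<and>
     card {i. i < length D \<and> kind D i = YCol} = K \<and>
     card {i. i < length D \<and> kind D i = XCol} = L \<and>
     (\<forall>i < length D. crosses D i \<le> height K L D i) \<and>
     (\<forall>i < length D. \<forall>j. kind D i = YCol \<and> first_uniform_right K L D i j \<longrightarrow>
        (white_xcol D j \<longrightarrow> crosses D i \<ge> 1) \<and>
        (crossed_xcol K L D j \<longrightarrow> crosses D i < height K L D i))}"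

definition place_var :: "drawing \<Rightarrow> nat \<Rightarrow> var" where
  "place_var D i = (case kind D i of XCol \<Rightarrow> X (Suc i) | YCol \<Rightarrow> Y (Suc i))"

definition partial_drawing :: "drawing \<Rightarrow> poly_xy \<Rightarrow> poly_xy" where
  "partial_drawing D =
     pderivs (concat (map (\<lambda>i. replicate (crosses D i) (place_var D i)) [0..<length D]))"

end

theory Submission
  imports Defs "HOL-Combinatorics.Multiset_Permutations"
begin

text \<open>Every \<open>\<partial>\<^sub>D \<Delta>\<close> lies in \<open>M\<close>, so it has to be shown that these derivatives are numerous enough.
  Two bounds that meet at \<open>n!\<close> do this.

  \<^emph>\<open>At most \<open>n!\<close> derivatives span \<open>M\<close>.\<close> Since \<open>\<partial>\<^bsub>x i\<^esub> \<partial>\<^bsub>y i\<^esub>\<close> kills \<open>\<Delta>\<close>, a derivative that survives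
  is given by a vector \<open>v\<close> of \<open>n\<close> integers: \<open>v\<^sub>i > 0\<close> is the order in \<open>x\<^sub>i\<close> and \<open>- v\<^sub>i > 0\<close> the order in
  \<open>y\<^sub>i\<close>. At most \<open>L\<close> entries are positive and at most \<open>K\<close> negative, so the entry in position \<open>L + 1\<close> of
  the sorted vector is \<open>0\<close>. The elementary symmetric functions of the \<open>\<partial>\<^bsub>x i\<^esub>\<close>, and likewise of the
  \<open>\<partial>\<^bsub>y i\<^esub>\<close>, kill \<open>\<Delta>\<close> as well. Used as a straightening law in the manner of Garsia and Stanton, they leave
  only the vectors whose sorted values drop by \<open>1\<close> at the descents of the sorting permutation and
  nowhere else (\<open>Delta_deriv_in_span_straight\<close>). Such a vector is determined by its sorting
  permutation (\<open>straight_determined\<close>).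

  \<^emph>\<open>The drawings give \<open>n!\<close> independent derivatives.\<close> Removing the leftmost column yields a recursion
  for the number of drawings, which is \<open>n!\<close> (\<open>card_admissible_drawings\<close>). For independence, take the
  coefficient of \<open>\<partial>\<^sub>D \<Delta>\<close> at the monomial that records the white cells of a drawing \<open>E\<close>. It is nonzero
  exactly if the crosses of \<open>D\<close> and the white cells of \<open>E\<close> together form a term of \<open>\<Delta>\<close>, in which case
  write \<open>D \<rightarrow> E\<close>; in particular \<open>D \<rightarrow> D\<close>. The matrix of these coefficients is triangular in a suitable
  order if \<open>\<rightarrow>\<close> has no cycles apart from loops. This is \<open>closed_walk_constant\<close>, the combinatorial
  heart of the proof and the place where the rules about uniform \<open>x\<close>-columns are used.

  A linearly independent family of size \<open>n!\<close> inside the span of at most \<open>n!\<close> vectors spans the same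
  space.\<close>

section \<open>Coefficients of derivatives\<close>

lemma lookup_const_times: "Poly_Mapping.lookup (Poly_Mapping.single 0 c * p) m = (c :: rat) * Poly_Mapping.lookup p m"
  for p :: poly_xy
  unfolding mult_map_scale_conv_mult[symmetric] by (simp add: Poly_Mapping.map.rep_eq when_def)

lemma lookup_scale_poly: "Poly_Mapping.lookup (scale_poly c p) m = c * Poly_Mapping.lookup p m"
  by (simp add: scale_poly_def Const_def lookup_const_times)

definition exponents :: "var list \<Rightarrow> monomial" where
  "exponents vs = sum_list (map (\<lambda>v. Poly_Mapping.single v 1) vs)"

lemma exponents_simps [simp]:
  "exponents [] = 0"
  "exponents (v # vs) = Poly_Mapping.single v 1 + exponents vs"
  "exponents (vs @ ws) = exponents vs + exponents ws"
  by (simp_all add: exponents_def)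

lemma exponents_replicate [simp]: "exponents (replicate k v) = Poly_Mapping.single v k"
  by (induction k) (simp_all flip: single_add)

lemma lookup_exponents: "Poly_Mapping.lookup (exponents vs) v = count_list vs v"
  by (induction vs) (auto simp: lookup_add lookup_single when_def)

definition factorials :: "monomial \<Rightarrow> rat" where
  "factorials m = (\<Prod>v\<in>Poly_Mapping.keys m. fact (Poly_Mapping.lookup m v))"

lemma factorials_superset:
  assumes "finite A" "Poly_Mapping.keys m \<subseteq> A"
  shows "factorials m = (\<Prod>v\<in>A. fact (Poly_Mapping.lookup m v))"
  unfolding factorials_def by (rule prod.mono_neutral_left) (use assms in \<open>auto simp: in_keys_iff\<close>)

lemma factorials_nonzero [simp]: "factorials m \<noteq> 0"
  by (simp add: factorials_def)

lemma factorials_add_single: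
  "factorials (m + Poly_Mapping.single v 1) = of_nat (Poly_Mapping.lookup m v + 1) * factorials m"
proof -
  let ?A = "insert v (Poly_Mapping.keys m)"
  have "Poly_Mapping.keys (m + Poly_Mapping.single v 1) \<subseteq> ?A"
    by (auto simp: in_keys_iff lookup_add lookup_single when_def split: if_splits)
  then have "factorials (m + Poly_Mapping.single v 1) =
      (\<Prod>w\<in>?A. fact (Poly_Mapping.lookup (m + Poly_Mapping.single v 1) w))"
    by (intro factorials_superset) auto
  also have "\<dots> = (\<Prod>w\<in>?A. (if w = v then of_nat (Poly_Mapping.lookup m v + 1) else 1) * fact (Poly_Mapping.lookup m w))"
    by (rule prod.cong) (auto simp: lookup_add lookup_single when_def)
  also have "\<dots> = of_nat (Poly_Mapping.lookup m v + 1) * (\<Prod>w\<in>?A. fact (Poly_Mapping.lookup m w))"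
    unfolding prod.distrib by (subst prod.delta) auto
  also have "(\<Prod>w\<in>?A. fact (Poly_Mapping.lookup m w)) = factorials m"
    by (rule factorials_superset[symmetric]) auto
  finally show ?thesis .
qed

text \<open>In the basis of divided powers a derivative merely shifts exponents. Multiplying each coefficient by
  the factorials of its monomial passes to that basis and leaves no numerical factors behind.\<close>

lemma lookup_pderivs:
  "factorials m * Poly_Mapping.lookup (pderivs vs p) m =
     factorials (m + exponents vs) * Poly_Mapping.lookup p (m + exponents vs)"
proof (induction vs arbitrary: m)
  case (Cons v vs)
  let ?m = "m + Poly_Mapping.single v 1"
  have "factorials m * Poly_Mapping.lookup (pderivs (v # vs) p) m =
      factorials ?m * Poly_Mapping.lookup (pderivs vs p) ?m"
    unfolding pderivs_def foldr.simps o_def lookup_pderiv_var factorials_add_single by simp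
  then show ?case
    unfolding Cons.IH by (simp add: add.assoc)
qed (simp add: pderivs_def)

lemma pderivs_cong_exponents:
  assumes "exponents vs = exponents ws"
  shows "pderivs vs p = pderivs ws p"
proof (rule poly_mapping_eqI)
  fix m
  have "factorials m * Poly_Mapping.lookup (pderivs vs p) m = factorials m * Poly_Mapping.lookup (pderivs ws p) m"
    unfolding lookup_pderivs assms ..
  then show "Poly_Mapping.lookup (pderivs vs p) m = Poly_Mapping.lookup (pderivs ws p) m"
    by simp
qed

section \<open>Monomials encoded by integer vectors\<close>

text \<open>A positive entry \<open>v i\<close> stands for a power of \<open>X (Suc i)\<close>, a negative one for a power of
  \<open>Y (Suc i)\<close>; the shift by one reconciles the numbering of places from \<open>0\<close> with that of variables from \<open>1\<close>.\<close>

definition vec_monomial :: "nat \<Rightarrow> (nat \<Rightarrow> int) \<Rightarrow> monomial" where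
  "vec_monomial n v = (\<Sum>i<n. Poly_Mapping.single (X (Suc i)) (nat (v i)) + Poly_Mapping.single (Y (Suc i)) (nat (- v i)))"

text \<open>With the sign \<open>e\<close> as a parameter, a statement about \<open>axis e\<close> and \<open>e * v i\<close> covers the \<open>x\<close>- and the
  \<open>y\<close>-variables at once.\<close>

definition axis :: "int \<Rightarrow> nat \<Rightarrow> var" where
  "axis e i = (if e = 1 then X (Suc i) else Y (Suc i))"

lemma lookup_vec_monomial:
  "Poly_Mapping.lookup (vec_monomial n v) (X k) = (if 1 \<le> k \<and> k \<le> n then nat (v (k - 1)) else 0)"
  "Poly_Mapping.lookup (vec_monomial n v) (Y k) = (if 1 \<le> k \<and> k \<le> n then nat (- v (k - 1)) else 0)"
proof -
  have eq: "(\<Sum>i<n. if Suc i = k then f i else 0) = (if 1 \<le> k \<and> k \<le> n then f (k - 1) else (0::nat))" for f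
  proof (cases k)
    case (Suc k')
    then have "(\<Sum>i<n. if Suc i = k then f i else 0) = (\<Sum>i<n. if i = k' then f i else 0)"
      by (intro sum.cong) auto
    also have "\<dots> = (if k' < n then f k' else 0)"
      by (subst sum.delta) auto
    finally show ?thesis using Suc by auto
  qed simp
  have "Poly_Mapping.lookup (vec_monomial n v) (X k) = (\<Sum>i<n. if Suc i = k then nat (v i) else 0)"
    unfolding vec_monomial_def lookup_sum lookup_add lookup_single when_def by (rule sum.cong) auto
  then show "Poly_Mapping.lookup (vec_monomial n v) (X k) = (if 1 \<le> k \<and> k \<le> n then nat (v (k - 1)) else 0)"
    unfolding eq .
  have "Poly_Mapping.lookup (vec_monomial n v) (Y k) = (\<Sum>i<n. if Suc i = k then nat (- v i) else 0)"
    unfolding vec_monomial_def lookup_sum lookup_add lookup_single when_def by (rule sum.cong) auto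
  then show "Poly_Mapping.lookup (vec_monomial n v) (Y k) = (if 1 \<le> k \<and> k \<le> n then nat (- v (k - 1)) else 0)"
    unfolding eq .
qed

lemma vars_iff_axis:
  assumes "e = 1 \<or> e = -1"
  shows "v \<in> vars n \<longleftrightarrow> (\<exists>i<n. v = axis e i \<or> v = axis (- e) i)"
proof -
  have "v \<in> vars n \<longleftrightarrow> (\<exists>i<n. v = X (Suc i) \<or> v = Y (Suc i))"
    unfolding vars_def by (auto simp: image_iff) (metis Suc_le_D Suc_le_eq One_nat_def)+
  then show ?thesis using assms by (auto simp: axis_def)
qed

lemma lookup_vec_monomial_axis:
  assumes "i < n" "e = 1 \<or> e = -1"
  shows "Poly_Mapping.lookup (vec_monomial n v) (axis e i) = nat (e * v i)"
  using assms by (auto simp: axis_def lookup_vec_monomial)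

lemma lookup_vec_monomial_outside: "x \<notin> vars n \<Longrightarrow> Poly_Mapping.lookup (vec_monomial n v) x = 0"
  by (cases x) (auto simp: lookup_vec_monomial vars_def)

lemma eq_vec_monomial_iff:
  assumes "e = 1 \<or> e = -1"
  shows "m = vec_monomial n v \<longleftrightarrow> (\<forall>x. x \<notin> vars n \<longrightarrow> Poly_Mapping.lookup m x = 0) \<and>
    (\<forall>i<n. Poly_Mapping.lookup m (axis e i) = nat (e * v i) \<and> Poly_Mapping.lookup m (axis (- e) i) = nat (- e * v i))"
    (is "_ \<longleftrightarrow> ?r")
proof
  assume "m = vec_monomial n v"
  then show ?r
    using lookup_vec_monomial_axis[of _ n e] lookup_vec_monomial_axis[of _ n "- e"] assms by (auto simp: lookup_vec_monomial_outside)
next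
  assume r: ?r
  show "m = vec_monomial n v"
  proof (rule poly_mapping_eqI)
    fix x
    show "Poly_Mapping.lookup m x = Poly_Mapping.lookup (vec_monomial n v) x"
    proof (cases "x \<in> vars n")
      case True
      then obtain i where "i < n" "x = axis e i \<or> x = axis (- e) i"
        using vars_iff_axis[OF assms] by blast
      then show ?thesis
        using r lookup_vec_monomial_axis[of i n e] lookup_vec_monomial_axis[of i n "- e"] assms by auto
    qed (use r lookup_vec_monomial_outside in auto)
  qed
qed

lemma vec_monomial_eq_iff: "vec_monomial n v = vec_monomial n w \<longleftrightarrow> (\<forall>i<n. v i = w i)"
proof -
  have "nat (v i) = nat (w i) \<and> nat (- v i) = nat (- w i) \<longleftrightarrow> v i = w i" for i
    by linarith
  then show ?thesis
    unfolding eq_vec_monomial_iff[of 1, simplified] 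
    using lookup_vec_monomial_axis[of _ n 1] lookup_vec_monomial_axis[of _ n "-1"] lookup_vec_monomial_outside by auto
qed

lemma factorials_vec_monomial:
  "factorials (vec_monomial n v) = (\<Prod>i<n. fact (nat (v i)) * fact (nat (- v i)))"
proof -
  let ?X = "(\<lambda>i. X (Suc i)) ` {..<n}" and ?Y = "(\<lambda>i. Y (Suc i)) ` {..<n}"
  have "Poly_Mapping.keys (vec_monomial n v) \<subseteq> ?X \<union> ?Y"
  proof
    fix x assume "x \<in> Poly_Mapping.keys (vec_monomial n v)"
    then have "x \<in> vars n"
      using lookup_vec_monomial_outside[of x n v] by (cases "x \<in> vars n") (auto simp: in_keys_iff)
    then show "x \<in> ?X \<union> ?Y"
      using vars_iff_axis[of 1] by (auto simp: axis_def)
  qed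
  then have "factorials (vec_monomial n v) = (\<Prod>x\<in>?X \<union> ?Y. fact (Poly_Mapping.lookup (vec_monomial n v) x))"
    by (intro factorials_superset) auto
  also have "\<dots> = (\<Prod>x\<in>?X. fact (Poly_Mapping.lookup (vec_monomial n v) x)) * (\<Prod>x\<in>?Y. fact (Poly_Mapping.lookup (vec_monomial n v) x))"
    by (rule prod.union_disjoint) auto
  also have "\<dots> = (\<Prod>i<n. fact (nat (v i))) * (\<Prod>i<n. fact (nat (- v i)))"
    by (simp add: prod.reindex inj_on_def lookup_vec_monomial)
  finally show ?thesis by (simp add: prod.distrib)
qed

section \<open>The terms of the determinant of a hook\<close>

text \<open>The cells of the hook are numbered along the hook by the integers from \<open>-K\<close> (end of the arm of
  powers of \<open>y\<close>) through \<open>0\<close> (the corner) to \<open>L\<close>, so that a term of the determinant is a bijection from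
  the places to this interval.\<close>

definition hook_val :: "nat \<Rightarrow> nat \<Rightarrow> int" where
  "hook_val K j = (if j \<le> K then - int j else int (j - K))"

lemma inj_hook_val: "inj (hook_val K)"
  by (rule injI) (auto simp: hook_val_def split: if_splits)

lemma hook_val_image: "hook_val K ` {0..<K + L + 1} = {- int K .. int L}"
proof (intro equalityI subsetI)
  fix z assume z: "z \<in> {- int K .. int L}"
  show "z \<in> hook_val K ` {0..<K + L + 1}"
  proof (rule image_eqI)
    show "z = hook_val K (if z \<le> 0 then nat (- z) else K + nat z)"
      using z by (auto simp: hook_val_def)
    show "(if z \<le> 0 then nat (- z) else K + nat z) \<in> {0..<K + L + 1}"
      using z by auto
  qed
qed (auto simp: hook_val_def split: if_splits)

lemma biexponents_hook_nth:
  assumes "j < K + L + 1"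
  shows "biexponents (hook K L) ! j = (nat (hook_val K j), nat (- hook_val K j))"
  using assms unfolding biexponents_hook by (auto simp: nth_append hook_val_def simp del: upt_Suc)

lemma Var_power: "Var v ^ k = Poly_Mapping.single (Poly_Mapping.single v k) 1"
  by (induction k) (simp_all add: Var_def mult_single flip: single_add)

lemma prod_single_one:
  "finite A \<Longrightarrow> (\<Prod>i\<in>A. Poly_Mapping.single (f i) (1::rat)) = Poly_Mapping.single (\<Sum>i\<in>A. f i) 1"
  for f :: "'a \<Rightarrow> monomial"
  by (induction A rule: finite_induct) (simp_all add: mult_single)

lemma Delta_hook:
  "Delta (hook K L) = (\<Sum>\<pi> | \<pi> permutes {0..<K + L + 1}.
     signof \<pi> * Poly_Mapping.single (vec_monomial (K + L + 1) (hook_val K \<circ> \<pi>)) 1)"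
proof -
  let ?n = "K + L + 1"
  have "Delta (hook K L) = det (mat ?n ?n (\<lambda>(i, j).
      case biexponents (hook K L) ! j of (p, q) \<Rightarrow> Var (X (Suc i)) ^ p * Var (Y (Suc i)) ^ q))"
    by (simp add: Delta_def sum_list_hook Let_def)
  also have "\<dots> = (\<Sum>\<pi> | \<pi> permutes {0..<?n}. signof \<pi> *
      (\<Prod>i = 0..<?n. mat ?n ?n (\<lambda>(i, j).
         case biexponents (hook K L) ! j of (p, q) \<Rightarrow> Var (X (Suc i)) ^ p * Var (Y (Suc i)) ^ q) $$ (i, \<pi> i)))"
    by (rule det_def') simp
  also have "\<dots> = (\<Sum>\<pi> | \<pi> permutes {0..<?n}. signof \<pi> *
      Poly_Mapping.single (vec_monomial ?n (hook_val K \<circ> \<pi>)) 1)"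
  proof (rule sum.cong[OF refl], rule arg_cong[where f = "(*) _"])
    fix \<pi> assume "\<pi> \<in> {\<pi>. \<pi> permutes {0..<?n}}"
    then have \<pi>: "\<pi> i < ?n" if "i < ?n" for i
      using that permutes_in_image[of \<pi> "{0..<?n}" i] by simp
    have "(\<Prod>i = 0..<?n. mat ?n ?n (\<lambda>(i, j).
         case biexponents (hook K L) ! j of (p, q) \<Rightarrow> Var (X (Suc i)) ^ p * Var (Y (Suc i)) ^ q) $$ (i, \<pi> i)) =
       (\<Prod>i = 0..<?n. Poly_Mapping.single (Poly_Mapping.single (X (Suc i)) (nat (hook_val K (\<pi> i))) +
          Poly_Mapping.single (Y (Suc i)) (nat (- hook_val K (\<pi> i)))) 1)"
    proof (rule prod.cong[OF refl])
      fix i assume "i \<in> {0..<?n}"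
      then have i: "i < ?n" by simp
      show "mat ?n ?n (\<lambda>(i, j).
         case biexponents (hook K L) ! j of (p, q) \<Rightarrow> Var (X (Suc i)) ^ p * Var (Y (Suc i)) ^ q) $$ (i, \<pi> i) =
         Poly_Mapping.single (Poly_Mapping.single (X (Suc i)) (nat (hook_val K (\<pi> i))) +
          Poly_Mapping.single (Y (Suc i)) (nat (- hook_val K (\<pi> i)))) 1"
        unfolding index_mat(1)[OF i \<pi>[OF i]] prod.case biexponents_hook_nth[OF \<pi>[OF i]]
        by (simp add: Var_power mult_single)
    qed
    also have "\<dots> = Poly_Mapping.single (vec_monomial ?n (hook_val K \<circ> \<pi>)) 1"
      by (simp only: vec_monomial_def atLeast0LessThan comp_def prod_single_one finite_lessThan)
    finally show "(\<Prod>i = 0..<?n. mat ?n ?n (\<lambda>(i, j).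
         case biexponents (hook K L) ! j of (p, q) \<Rightarrow> Var (X (Suc i)) ^ p * Var (Y (Suc i)) ^ q) $$ (i, \<pi> i)) =
       Poly_Mapping.single (vec_monomial ?n (hook_val K \<circ> \<pi>)) 1" .
  qed
  finally show ?thesis .
qed

lemma lookup_Delta:
  "Poly_Mapping.lookup (Delta (hook K L)) m = (\<Sum>\<pi> | \<pi> permutes {0..<K + L + 1}.
     signof \<pi> * of_bool (m = vec_monomial (K + L + 1) (hook_val K \<circ> \<pi>)))"
proof -
  have "Poly_Mapping.lookup (of_int k * Poly_Mapping.single m' 1 :: poly_xy) m = of_int k * of_bool (m = m')" for k m'
    unfolding single_of_int[symmetric] lookup_const_times by (auto simp: lookup_single when_def)
  then show ?thesis
    unfolding Delta_hook lookup_sum by simp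
qed

lemma lookup_Delta_nonzero:
  assumes "Poly_Mapping.lookup (Delta (hook K L)) m \<noteq> 0"
  obtains \<pi> where "\<pi> permutes {0..<K + L + 1}" "m = vec_monomial (K + L + 1) (hook_val K \<circ> \<pi>)"
proof -
  have "\<exists>\<pi>. \<pi> permutes {0..<K + L + 1} \<and> m = vec_monomial (K + L + 1) (hook_val K \<circ> \<pi>)"
  proof (rule ccontr)
    assume "\<not> ?thesis"
    then have "Poly_Mapping.lookup (Delta (hook K L)) m = 0"
      unfolding lookup_Delta by (intro sum.neutral) auto
    then show False using assms by simp
  qed
  then show thesis using that by blast
qed

lemma lookup_Delta_term:
  assumes "\<pi> permutes {0..<K + L + 1}"
  shows "Poly_Mapping.lookup (Delta (hook K L)) (vec_monomial (K + L + 1) (hook_val K \<circ> \<pi>)) = signof \<pi>"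
proof -
  have "vec_monomial (K + L + 1) (hook_val K \<circ> \<pi>) = vec_monomial (K + L + 1) (hook_val K \<circ> \<sigma>) \<longleftrightarrow> \<sigma> = \<pi>"
    if "\<sigma> permutes {0..<K + L + 1}" for \<sigma>
  proof
    assume "vec_monomial (K + L + 1) (hook_val K \<circ> \<pi>) = vec_monomial (K + L + 1) (hook_val K \<circ> \<sigma>)"
    then have "\<sigma> i = \<pi> i" if "i < K + L + 1" for i
      using that injD[OF inj_hook_val] unfolding vec_monomial_eq_iff by fastforce
    moreover have "\<sigma> i = \<pi> i" if "\<not> i < K + L + 1" for i
      using that assms \<open>\<sigma> permutes _\<close> by (simp add: permutes_not_in)
    ultimately show "\<sigma> = \<pi>" by blast
  qed simp
  then have "Poly_Mapping.lookup (Delta (hook K L)) (vec_monomial (K + L + 1) (hook_val K \<circ> \<pi>)) =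
     (\<Sum>\<sigma> | \<sigma> permutes {0..<K + L + 1}. if \<sigma> = \<pi> then signof \<pi> else 0)"
    unfolding lookup_Delta by (intro sum.cong) auto
  then show ?thesis
    using assms by (simp add: finite_permutations)
qed

text \<open>All terms carry the same exponents, only distributed differently over the places; the normalising
  factorials are therefore one global constant.\<close>

lemma factorials_Delta:
  assumes "Poly_Mapping.lookup (Delta (hook K L)) m \<noteq> 0"
  shows "factorials m = factorials (vec_monomial (K + L + 1) (hook_val K))"
proof -
  obtain \<pi> where \<pi>: "\<pi> permutes {0..<K + L + 1}" and m: "m = vec_monomial (K + L + 1) (hook_val K \<circ> \<pi>)"
    using assms by (rule lookup_Delta_nonzero)
  have "factorials m = (\<Prod>i\<in>{..<K + L + 1}. ((\<lambda>j. fact (nat (hook_val K j)) * fact (nat (- hook_val K j))) \<circ> \<pi>) i)"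
    unfolding m factorials_vec_monomial by simp
  also have "\<dots> = (\<Prod>j\<in>{..<K + L + 1}. fact (nat (hook_val K j)) * fact (nat (- hook_val K j)))"
    by (rule prod.permute[symmetric]) (use \<pi> in \<open>simp add: atLeast0LessThan\<close>)
  finally show ?thesis unfolding factorials_vec_monomial .
qed

text \<open>This is the vanishing of a determinant with two equal columns, for weights that need not be
  products.\<close>

lemma sum_signof_eq_0:
  fixes g :: "(nat \<Rightarrow> nat) \<Rightarrow> rat"
  assumes "j < n" "j0 < n" "j \<noteq> j0"
    and inv: "\<And>\<pi>. \<pi> permutes {0..<n} \<Longrightarrow> g (Transposition.transpose j j0 \<circ> \<pi>) = g \<pi>"
  shows "(\<Sum>\<pi> | \<pi> permutes {0..<n}. signof \<pi> * g \<pi>) = 0"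
proof -
  let ?\<tau> = "Transposition.transpose j j0" and ?S = "{\<pi>. \<pi> permutes {0..<n}}"
  have \<tau>: "?\<tau> permutes {0..<n}"
    using assms by (intro permutes_swap_id) auto
  have "(\<Sum>\<pi>\<in>?S. signof \<pi> * g \<pi>) = (\<Sum>\<pi>\<in>?S. signof (?\<tau> \<circ> \<pi>) * g (?\<tau> \<circ> \<pi>))"
    by (rule sum.reindex_bij_witness[of _ "\<lambda>\<pi>. ?\<tau> \<circ> \<pi>" "\<lambda>\<pi>. ?\<tau> \<circ> \<pi>"])
      (use \<tau> in \<open>auto simp: permutes_compose o_assoc\<close>)
  also have "\<dots> = (\<Sum>\<pi>\<in>?S. - (signof \<pi> * g \<pi>))"
  proof (rule sum.cong[OF refl])
    fix \<pi> assume "\<pi> \<in> ?S"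
    then have \<pi>: "\<pi> permutes {0..<n}" by simp
    have "sign (?\<tau> \<circ> \<pi>) = - sign \<pi>"
      using sign_compose[of ?\<tau> \<pi>] \<pi> \<tau> assms(3) permutation_permutes
      by (auto simp: sign_swap_id)
    then show "signof (?\<tau> \<circ> \<pi>) * g (?\<tau> \<circ> \<pi>) = - (signof \<pi> * g \<pi>)"
      using inv[OF \<pi>] by simp
  qed
  also have "\<dots> = - (\<Sum>\<pi>\<in>?S. signof \<pi> * g \<pi>)"
    by (rule sum_negf)
  finally show ?thesis by simp
qed

section \<open>Differential operators that annihilate the determinant\<close>

definition var_list :: "nat \<Rightarrow> (nat \<Rightarrow> int) \<Rightarrow> var list" where
  "var_list n v = concat (map (\<lambda>i. replicate (nat (v i)) (X (Suc i)) @ replicate (nat (- v i)) (Y (Suc i))) [0..<n])"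

lemma exponents_var_list: "exponents (var_list n v) = vec_monomial n v"
  by (induction n) (simp_all add: var_list_def vec_monomial_def)

text \<open>By \<open>exponents_var_list\<close> this is the derivative of \<open>\<Delta>\<close> encoded by \<open>v\<close>.\<close>

abbreviation Delta_deriv :: "nat \<Rightarrow> nat \<Rightarrow> (nat \<Rightarrow> int) \<Rightarrow> poly_xy" where
  "Delta_deriv K L v \<equiv> pderivs (var_list (K + L + 1) v) (Delta (hook K L))"

text \<open>The \<open>r\<close>-th elementary symmetric function of the derivatives along one axis kills \<open>\<Delta>\<close>. Distributing the
  derivatives over the columns of the determinant instead of its rows gives a sum over sets \<open>C\<close> of
  columns, of the determinant in which the columns in \<open>C\<close> are differentiated. In divided powers the
  derivative of a column is its neighbour nearer to the corner of the hook, or zero at the corner and on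
  the other arm. Hence either some column of \<open>C\<close> becomes zero, or the column of \<open>C\<close> nearest to the
  corner becomes equal to a column outside \<open>C\<close>.\<close>

lemma sum_over_subsets_lookup_Delta:
  fixes K L r :: nat and e :: int
  assumes e: "e = 1 \<or> e = -1" and r: "0 < r"
  defines "n \<equiv> K + L + 1"
  shows "(\<Sum>U | U \<subseteq> {0..<n} \<and> card U = r.
    Poly_Mapping.lookup (Delta (hook K L)) (w + (\<Sum>i\<in>U. Poly_Mapping.single (axis e i) 1))) = 0"
proof -
  let ?N = "{0..<n}" and ?h = "hook_val K"
  let ?S = "{U. U \<subseteq> ?N \<and> card U = r}" and ?P = "{\<pi>. \<pi> permutes ?N}"
  define sh where "sh U = w + (\<Sum>i\<in>U. Poly_Mapping.single (axis e i) (1::nat))" for U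
  \<comment> \<open>Columns \<open>C\<close> correspond to the rows \<open>pre \<pi> C\<close> under the permutation \<open>\<pi>\<close>.\<close>
  define pre where "pre \<pi> C = {i\<in>?N. \<pi> i \<in> C}" for \<pi> :: "nat \<Rightarrow> nat" and C
  have "(\<Sum>U\<in>?S. Poly_Mapping.lookup (Delta (hook K L)) (sh U)) =
      (\<Sum>\<pi>\<in>?P. \<Sum>U\<in>?S. signof \<pi> * of_bool (sh U = vec_monomial n (?h \<circ> \<pi>)))"
    unfolding lookup_Delta n_def by (rule sum.swap)
  also have "\<dots> = (\<Sum>\<pi>\<in>?P. \<Sum>C\<in>?S. signof \<pi> * of_bool (sh (pre \<pi> C) = vec_monomial n (?h \<circ> \<pi>)))"
  proof (rule sum.cong[OF refl])
    fix \<pi> assume "\<pi> \<in> ?P"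
    then have \<pi>: "\<pi> permutes ?N" by simp
    have pre_image: "pre \<pi> (\<pi> ` U) = U" if "U \<subseteq> ?N" for U
      using that permutes_inj[OF \<pi>] by (auto simp: pre_def inj_image_mem_iff)
    have image_pre: "\<pi> ` pre \<pi> C = C" if "C \<subseteq> ?N" for C
    proof (intro equalityI subsetI)
      fix c assume "c \<in> C"
      then have "c \<in> \<pi> ` ?N" using that permutes_image[OF \<pi>] by auto
      then show "c \<in> \<pi> ` pre \<pi> C" using \<open>c \<in> C\<close> by (auto simp: pre_def)
    qed (auto simp: pre_def)
    have card_image: "card (\<pi> ` U) = card U" for U
      using permutes_inj[OF \<pi>] by (meson card_image inj_on_subset subset_UNIV)
    have image_sub: "\<pi> ` U \<subseteq> ?N" if "U \<subseteq> ?N" for U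
      using that permutes_image[OF \<pi>] by blast
    have pre_card: "card (pre \<pi> C) = card C" if "C \<subseteq> ?N" for C
      using card_image[of "pre \<pi> C"] image_pre[OF that] by simp
    show "(\<Sum>U\<in>?S. signof \<pi> * of_bool (sh U = vec_monomial n (?h \<circ> \<pi>))) =
        (\<Sum>C\<in>?S. signof \<pi> * of_bool (sh (pre \<pi> C) = vec_monomial n (?h \<circ> \<pi>)) :: rat)"
      by (rule sum.reindex_bij_witness[of _ "pre \<pi>" "\<lambda>U. \<pi> ` U"])
        (use pre_image image_pre card_image image_sub pre_card in \<open>auto simp: pre_def\<close>)
  qed
  also have "\<dots> = (\<Sum>C\<in>?S. \<Sum>\<pi>\<in>?P. signof \<pi> * of_bool (sh (pre \<pi> C) = vec_monomial n (?h \<circ> \<pi>)))"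
    by (rule sum.swap)
  also have "\<dots> = 0"
  proof (rule sum.neutral, rule ballI)
    fix C assume "C \<in> ?S"
    then have C: "C \<subseteq> ?N" "C \<noteq> {}" "finite C"
      using r finite_subset[of C ?N] by auto
    have lookup_pre: "Poly_Mapping.lookup (sh (pre \<pi> C)) (axis e i) =
          Poly_Mapping.lookup w (axis e i) + of_bool (\<pi> i \<in> C)"
        "Poly_Mapping.lookup (sh (pre \<pi> C)) (axis (- e) i) = Poly_Mapping.lookup w (axis (- e) i)"
      if "i < n" for \<pi> i
      using e that by (auto simp: sh_def pre_def lookup_add lookup_sum lookup_single axis_def when_def)
    have lookup_out: "Poly_Mapping.lookup (sh (pre \<pi> C)) x = Poly_Mapping.lookup w x" if "x \<notin> vars n" for \<pi> x
    proof -
      have "axis e i \<noteq> x" if "i \<in> pre \<pi> C" for i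
        using that \<open>x \<notin> vars n\<close> vars_iff_axis[OF e, of x n] by (auto simp: pre_def)
      then show ?thesis
        by (simp add: sh_def lookup_add lookup_sum lookup_single when_def)
    qed
    \<comment> \<open>\<open>G j i\<close>: the entry of the differentiated column \<open>j\<close> in row \<open>i\<close> is the monomial prescribed by \<open>w\<close>.\<close>
    define G where "G j i \<longleftrightarrow> Poly_Mapping.lookup w (axis e i) + of_bool (j \<in> C) = nat (e * ?h j) \<and>
        Poly_Mapping.lookup w (axis (- e) i) = nat (- e * ?h j)" for i j
    have match: "sh (pre \<pi> C) = vec_monomial n (?h \<circ> \<pi>) \<longleftrightarrow>
        (\<forall>x. x \<notin> vars n \<longrightarrow> Poly_Mapping.lookup w x = 0) \<and> (\<forall>i<n. G (\<pi> i) i)" for \<pi>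
      unfolding eq_vec_monomial_iff[OF e] G_def using lookup_pre lookup_out by auto
    obtain j where j: "j \<in> C" "\<And>j'. j' \<in> C \<Longrightarrow> e * ?h j \<le> e * ?h j'"
      using arg_min_if_finite[OF C(3,2), of "\<lambda>j. e * ?h j"] by (metis linorder_not_less)
    have jn: "j < n" using j(1) C(1) by auto
    show "(\<Sum>\<pi>\<in>?P. signof \<pi> * of_bool (sh (pre \<pi> C) = vec_monomial n (?h \<circ> \<pi>))) = (0 :: rat)"
    proof (cases "e * ?h j \<le> 0")
      case True
      have "\<not> (\<forall>i<n. G (\<pi> i) i)" if \<pi>: "\<pi> permutes ?N" for \<pi>
      proof
        assume *: "\<forall>i<n. G (\<pi> i) i"
        obtain i where "i < n" "\<pi> i = j"
          using permutes_image[OF \<pi>] jn by (metis atLeastLessThan_iff imageE zero_le)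
        then show False using * True j(1) by (auto simp: G_def)
      qed
      then show ?thesis unfolding match by (intro sum.neutral) auto
    next
      case False
      have "?h j \<in> {- int K .. int L}"
        using jn hook_val_image[of K L] unfolding n_def by (metis atLeastLessThan_iff imageI zero_le)
      then have "?h j - e \<in> {- int K .. int L}"
        using False e by auto
      then obtain j0 where j0: "j0 < n" "?h j0 = ?h j - e"
        unfolding hook_val_image[of K L, symmetric] n_def by auto
      have e2: "e * e = 1" using e by auto
      then have ej0: "e * ?h j0 = e * ?h j - 1" by (simp add: j0(2) right_diff_distrib)
      then have "j0 \<notin> C" using j(2)[of j0] by auto
      have "j \<noteq> j0" using ej0 by auto
      have "G j i \<longleftrightarrow> G j0 i" for i
        using False j(1) \<open>j0 \<notin> C\<close> ej0 by (auto simp: G_def nat_diff_distrib)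
      then have "G (Transposition.transpose j j0 k) i \<longleftrightarrow> G k i" for k i
        by (simp add: Transposition.transpose_def)
      then show ?thesis
        unfolding match by (intro sum_signof_eq_0[OF jn j0(1) \<open>j \<noteq> j0\<close>]) simp
    qed
  qed
  finally show ?thesis unfolding sh_def .
qed

lemma lookup_Delta_deriv:
  "factorials m * Poly_Mapping.lookup (Delta_deriv K L v) m =
     factorials (vec_monomial (K + L + 1) (hook_val K)) *
     Poly_Mapping.lookup (Delta (hook K L)) (m + vec_monomial (K + L + 1) v)"
  unfolding lookup_pderivs exponents_var_list using factorials_Delta
  by (metis mult_zero_right)

text \<open>No cell of a hook has both exponents positive.\<close>

lemma lookup_Delta_both_axes:
  assumes "e = 1 \<or> e = -1" "i < K + L + 1"
    "0 < Poly_Mapping.lookup m (axis e i)" "0 < Poly_Mapping.lookup m (axis (- e) i)"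
  shows "Poly_Mapping.lookup (Delta (hook K L)) m = 0"
proof (rule ccontr)
  assume "\<not> ?thesis"
  then obtain \<pi> where "m = vec_monomial (K + L + 1) (hook_val K \<circ> \<pi>)"
    by (rule lookup_Delta_nonzero)
  then show False
    using assms lookup_vec_monomial_axis[of i "K + L + 1" e] lookup_vec_monomial_axis[of i "K + L + 1" "- e"]
    by auto
qed

text \<open>The same relation, applied to a derivative \<open>v\<close>. The subsets on which some entry of \<open>v\<close> points
  along the other axis have dropped out, because \<open>\<partial>\<^bsub>x i\<^esub> \<partial>\<^bsub>y i\<^esub>\<close> kills \<open>\<Delta>\<close>; the remaining summands are
  again encoded by integer vectors.\<close>

lemma sum_Delta_deriv_eq_0:
  assumes e: "e = 1 \<or> e = -1" and r: "0 < r"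
  shows "(\<Sum>U | U \<subseteq> {0..<K + L + 1} \<and> card U = r \<and> (\<forall>i\<in>U. 0 \<le> e * v i).
    Delta_deriv K L (\<lambda>i. v i + (if i \<in> U then e else 0))) = 0"
    (is "sum ?f ?S = 0")
proof (rule poly_mapping_eqI)
  fix m
  let ?n = "K + L + 1"
  let ?T = "{U. U \<subseteq> {0..<?n} \<and> card U = r}"
  let ?D = "Poly_Mapping.lookup (Delta (hook K L))"
  let ?c = "factorials (vec_monomial ?n (hook_val K))"
  define sh where "sh U = (m + vec_monomial ?n v) + (\<Sum>i\<in>U. Poly_Mapping.single (axis e i) 1)" for U
  have finT: "finite ?T" by (rule finite_subset[of _ "Pow {0..<?n}"]) auto
  have lookup_axes: "Poly_Mapping.lookup (\<Sum>i\<in>U. Poly_Mapping.single (axis e i) (1::nat)) (axis e i) = of_bool (i \<in> U)"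
      "Poly_Mapping.lookup (\<Sum>i\<in>U. Poly_Mapping.single (axis e i) (1::nat)) (axis (- e) i) = 0"
    if "finite U" for U i
    using e that by (auto simp: lookup_sum lookup_single axis_def when_def)
  have inside: "m + vec_monomial ?n (\<lambda>i. v i + (if i \<in> U then e else 0)) = sh U" if U: "U \<in> ?S" for U
  proof -
    have "finite U" using U finite_subset by blast
    have e2: "e * e = 1" using e by auto
    have "vec_monomial ?n v + (\<Sum>i\<in>U. Poly_Mapping.single (axis e i) 1) =
        vec_monomial ?n (\<lambda>i. v i + (if i \<in> U then e else 0))"
      unfolding eq_vec_monomial_iff[OF e]
    proof (intro conjI allI impI)
      fix x assume x: "x \<notin> vars ?n"
      have "axis e i \<noteq> x" if "i \<in> U" for i
      proof -
        have "i < ?n" using that U by auto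
        then show ?thesis using x vars_iff_axis[OF e, of x ?n] by blast
      qed
      then show "Poly_Mapping.lookup (vec_monomial ?n v + (\<Sum>i\<in>U. Poly_Mapping.single (axis e i) 1)) x = 0"
        using x by (simp add: lookup_add lookup_sum lookup_single when_def lookup_vec_monomial_outside)
    next
      fix i assume i: "i < ?n"
      have a: "Poly_Mapping.lookup (vec_monomial ?n v) (axis e i) = nat (e * v i)"
        and b: "Poly_Mapping.lookup (vec_monomial ?n v) (axis (- e) i) = nat (- e * v i)"
        using lookup_vec_monomial_axis[OF i, of e] lookup_vec_monomial_axis[OF i, of "- e"] e by auto
      have pos: "0 \<le> e * v i" if "i \<in> U" using U that by auto
      show "Poly_Mapping.lookup (vec_monomial ?n v + (\<Sum>i\<in>U. Poly_Mapping.single (axis e i) 1)) (axis e i) =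
          nat (e * (v i + (if i \<in> U then e else 0)))"
        unfolding lookup_add lookup_axes[OF \<open>finite U\<close>] a
        using pos by (auto simp: distrib_left e2 nat_add_distrib)
      show "Poly_Mapping.lookup (vec_monomial ?n v + (\<Sum>i\<in>U. Poly_Mapping.single (axis e i) 1)) (axis (- e) i) =
          nat (- e * (v i + (if i \<in> U then e else 0)))"
        unfolding lookup_add lookup_axes[OF \<open>finite U\<close>] b
        using pos by (auto simp: distrib_left e2)
    qed
    then show ?thesis by (simp add: sh_def add.assoc)
  qed
  have outside: "?D (sh U) = 0" if U: "U \<in> ?T - ?S" for U
  proof -
    have "finite U" using U finite_subset by blast
    obtain i where i: "i \<in> U" "e * v i < 0" "i < ?n"
      using U by force
    show ?thesis
    proof (rule lookup_Delta_both_axes[OF e i(3)])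
      show "0 < Poly_Mapping.lookup (sh U) (axis e i)"
        unfolding sh_def lookup_add lookup_axes[OF \<open>finite U\<close>] using i by simp
      have "Poly_Mapping.lookup (vec_monomial ?n v) (axis (- e) i) = nat (- e * v i)"
        using lookup_vec_monomial_axis[OF i(3), of "- e" v] e by auto
      then show "0 < Poly_Mapping.lookup (sh U) (axis (- e) i)"
        unfolding sh_def lookup_add using i(2) by linarith
    qed
  qed
  have "factorials m * Poly_Mapping.lookup (sum ?f ?S) m = (\<Sum>U\<in>?S. ?c * ?D (sh U))"
    unfolding lookup_sum sum_distrib_left lookup_Delta_deriv
    by (rule sum.cong[OF refl]) (simp only: inside)
  also have "\<dots> = ?c * (\<Sum>U\<in>?S. ?D (sh U))"
    by (simp add: sum_distrib_left)
  also have "(\<Sum>U\<in>?S. ?D (sh U)) = (\<Sum>U\<in>?T. ?D (sh U))"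
    by (rule sum.mono_neutral_left) (use finT outside in auto)
  also have "\<dots> = 0"
    unfolding sh_def by (rule sum_over_subsets_lookup_Delta[OF e r])
  finally show "Poly_Mapping.lookup (sum ?f ?S) m = Poly_Mapping.lookup 0 m"
    by simp
qed

lemma Delta_deriv_cong: "(\<And>i. i < K + L + 1 \<Longrightarrow> v i = w i) \<Longrightarrow> Delta_deriv K L v = Delta_deriv K L w"
  by (rule pderivs_cong_exponents) (simp add: exponents_var_list vec_monomial_eq_iff)

text \<open>A term of \<open>\<Delta>\<close> involves exactly \<open>L\<close> of the variables \<open>x\<close> and \<open>K\<close> of the variables \<open>y\<close>.\<close>

lemma Delta_deriv_many_signs:
  assumes e: "e = 1 \<or> e = -1"
    and many: "card {i. i < K + L + 1 \<and> 0 < e * v i} > (if e = 1 then L else K)"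
  shows "Delta_deriv K L v = 0"
proof (rule poly_mapping_eqI)
  fix m
  let ?n = "K + L + 1"
  have "Poly_Mapping.lookup (Delta (hook K L)) (m + vec_monomial ?n v) = 0"
  proof (rule ccontr)
    assume "\<not> ?thesis"
    then obtain \<pi> where \<pi>: "\<pi> permutes {0..<?n}" and m: "m + vec_monomial ?n v = vec_monomial ?n (hook_val K \<circ> \<pi>)"
      by (rule lookup_Delta_nonzero)
    have "0 < e * hook_val K (\<pi> i)" if "i < ?n" "0 < e * v i" for i
    proof -
      have "Poly_Mapping.lookup (m + vec_monomial ?n v) (axis e i) = nat (e * hook_val K (\<pi> i))"
        unfolding m using lookup_vec_monomial_axis[OF that(1) e] by simp
      then show ?thesis
        using that lookup_vec_monomial_axis[OF that(1) e, of v] by (simp add: lookup_add)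
    qed
    moreover have "\<pi> i < ?n" if "i < ?n" for i
      using that permutes_in_image[OF \<pi>, of i] by simp
    ultimately have "\<pi> ` {i. i < ?n \<and> 0 < e * v i} \<subseteq> {j. j < ?n \<and> 0 < e * hook_val K j}"
      by auto
    also have "\<dots> \<subseteq> (if e = 1 then {K + 1..<?n} else {1..K})"
      using e by (auto simp: hook_val_def split: if_splits)
    finally have "card (\<pi> ` {i. i < ?n \<and> 0 < e * v i}) \<le> card (if e = 1 then {K + 1..<?n} else {1..K})"
      by (intro card_mono) simp_all
    then have "card (\<pi> ` {i. i < ?n \<and> 0 < e * v i}) \<le> (if e = 1 then L else K)"
      by (simp split: if_splits)
    moreover have "inj_on \<pi> {i. i < ?n \<and> 0 < e * v i}"
      using permutes_inj[OF \<pi>] by (rule inj_on_subset) simp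
    ultimately show False
      using many by (simp add: card_image)
  qed
  then have "factorials m * Poly_Mapping.lookup (Delta_deriv K L v) m = 0"
    unfolding lookup_Delta_deriv by simp
  then show "Poly_Mapping.lookup (Delta_deriv K L v) m = Poly_Mapping.lookup 0 m"
    by simp
qed

section \<open>Straightening: a small spanning set\<close>

text \<open>The decrease behind the straightening law. Lowering \<open>v\<close> by one on its top set \<open>U\<close> and raising it by one
  on another set \<open>U'\<close> of the same size moves units from larger to smaller entries, so the sum of
  squares drops. The one exception is that entries equal to \<open>c\<close> trade places with entries equal to \<open>c - 1\<close>,
  and then the hypothesis \<open>sep\<close> makes the moment \<open>\<Sum>i. \<tau> i * v i\<close> grow.\<close>

lemma exchange_decreases:
  fixes v \<tau> :: "nat \<Rightarrow> int"
  assumes N: "finite N" "U' \<subseteq> N" and U: "U = {i\<in>N. c \<le> v i}"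
    and card: "card U' = card U" and neq: "U' \<noteq> U"
    and sep: "\<And>i i'. i \<in> N \<Longrightarrow> i' \<in> N \<Longrightarrow> v i = c \<Longrightarrow> v i' = c - 1 \<Longrightarrow> \<tau> i < \<tau> i'"
  defines "v' \<equiv> \<lambda>i. v i - of_bool (i \<in> U) + of_bool (i \<in> U')"
  shows "(\<Sum>i\<in>N. (v' i)\<^sup>2) < (\<Sum>i\<in>N. (v i)\<^sup>2) \<or>
    (\<Sum>i\<in>N. (v' i)\<^sup>2) = (\<Sum>i\<in>N. (v i)\<^sup>2) \<and> (\<Sum>i\<in>N. \<tau> i * v i) < (\<Sum>i\<in>N. \<tau> i * v' i)"
proof -
  define A where "A = U - U'"
  define B where "B = U' - U"
  have fin: "finite U" "finite U'" "finite A" "finite B"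
    using N U finite_subset[of U' N] by (auto simp: A_def B_def)
  have sub: "A \<subseteq> N" "B \<subseteq> N" using N U by (auto simp: A_def B_def)
  have "card U = card A + card (U \<inter> U')" "card U' = card B + card (U \<inter> U')"
    unfolding A_def B_def using fin card_Int_Diff[of U U'] card_Int_Diff[of U' U] by (simp_all add: Int_commute)
  then have AB: "card A = card B" using card by simp
  have "A \<noteq> {}"
    using card_subset_eq[of U' U] fin card neq by (auto simp: A_def)
  then have pos: "0 < card A" "0 < card B" using fin AB by (auto simp: card_gt_0_iff)
  then have "B \<noteq> {}" by auto
  have inA: "c \<le> v i" if "i \<in> A" for i using that U by (auto simp: A_def)
  have inB: "v i \<le> c - 1" if "i \<in> B" for i using that U N(2) by (auto simp: B_def)
  have split: "(\<Sum>i\<in>N. f i + (if i \<in> A then g i else 0) + (if i \<in> B then h i else 0)) =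
      sum f N + sum g A + sum h B" for f g h :: "nat \<Rightarrow> int"
    unfolding sum.distrib
    using sum.inter_restrict[OF N(1), of g A] sum.inter_restrict[OF N(1), of h B] sub
    by (simp add: Int_absorb1)
  have sq: "(\<Sum>i\<in>N. (v' i)\<^sup>2) = (\<Sum>i\<in>N. (v i)\<^sup>2) + (\<Sum>i\<in>A. 1 - 2 * v i) + (\<Sum>i\<in>B. 1 + 2 * v i)"
    unfolding split[symmetric]
    by (rule sum.cong) (auto simp: v'_def A_def B_def power2_eq_square algebra_simps)
  have lin: "(\<Sum>i\<in>N. \<tau> i * v' i) = (\<Sum>i\<in>N. \<tau> i * v i) + (\<Sum>i\<in>A. - \<tau> i) + (\<Sum>i\<in>B. \<tau> i)"
    unfolding split[symmetric]
    by (rule sum.cong) (auto simp: v'_def A_def B_def algebra_simps)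
  have leA: "(\<Sum>i\<in>A. 1 - 2 * v i) \<le> (\<Sum>i\<in>A. 1 - 2 * c)"
    using inA by (intro sum_mono) simp
  have leB: "(\<Sum>i\<in>B. 1 + 2 * v i) \<le> (\<Sum>i\<in>B. 2 * c - 1)"
    using inB by (intro sum_mono) fastforce
  have tot: "(\<Sum>i\<in>A. 1 - 2 * c) + (\<Sum>i\<in>B. 2 * c - 1) = 0"
    using AB by (simp add: algebra_simps)
  show ?thesis
  proof (cases "(\<exists>i\<in>A. c < v i) \<or> (\<exists>i\<in>B. v i < c - 1)")
    case True
    then have "(\<Sum>i\<in>A. 1 - 2 * v i) < (\<Sum>i\<in>A. 1 - 2 * c) \<or> (\<Sum>i\<in>B. 1 + 2 * v i) < (\<Sum>i\<in>B. 2 * c - 1)"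
    proof
      assume "\<exists>i\<in>A. c < v i"
      then have "(\<Sum>i\<in>A. 1 - 2 * v i) < (\<Sum>i\<in>A. 1 - 2 * c)"
        using inA fin by (intro sum_strict_mono_ex1) auto
      then show ?thesis ..
    next
      assume "\<exists>i\<in>B. v i < c - 1"
      then have "(\<Sum>i\<in>B. 1 + 2 * v i) < (\<Sum>i\<in>B. 2 * c - 1)"
      proof (intro sum_strict_mono_ex1 ballI)
        show "\<exists>i\<in>B. 1 + 2 * v i < 2 * c - 1"
          using \<open>\<exists>i\<in>B. v i < c - 1\<close> by (elim bexE) (rule bexI, simp_all)
        show "1 + 2 * v i \<le> 2 * c - 1" if "i \<in> B" for i using inB[OF that] by simp
      qed (rule fin)
      then show ?thesis ..
    qed
    then show ?thesis using sq leA leB tot by linarith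
  next
    case False
    then have eqA: "v i = c" if "i \<in> A" for i using inA[OF that] that by force
    have eqB: "v i = c - 1" if "i \<in> B" for i using False inB[OF that] that by force
    have "(\<Sum>i\<in>N. (v' i)\<^sup>2) = (\<Sum>i\<in>N. (v i)\<^sup>2)"
      unfolding sq using AB by (simp add: eqA eqB algebra_simps)
    moreover have "(\<Sum>i\<in>A. \<tau> i) < (\<Sum>i\<in>B. \<tau> i)"
    proof -
      define t where "t = Max (\<tau> ` A)"
      have "t \<in> \<tau> ` A" unfolding t_def using fin \<open>A \<noteq> {}\<close> by (intro Max_in) auto
      then have "t < \<tau> i" if "i \<in> B" for i
        using sep eqA eqB[OF that] sub that by blast
      then have "(\<Sum>i\<in>B. t + 1) \<le> (\<Sum>i\<in>B. \<tau> i)" by (intro sum_mono) fastforce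
      moreover have "(\<Sum>i\<in>A. \<tau> i) \<le> (\<Sum>i\<in>A. t)"
        unfolding t_def using fin by (intro sum_mono Max_ge) auto
      ultimately show ?thesis using AB pos by (simp add: algebra_simps)
    qed
    ultimately show ?thesis unfolding lin by (simp add: sum_negf)
  qed
qed

text \<open>The irreducible vectors of the straightening law: the occurring values form an interval around \<open>0\<close>, and
  for any two consecutive values the larger one occurs somewhere to the right of the smaller one, that is,
  in reversed order compared with sorting. The sign \<open>e\<close> covers both the positive and the negative values, with
  the levels \<open>c\<close> counted away from \<open>0\<close>. The bounds on the numbers of signs are those of
  \<open>Delta_deriv_many_signs\<close>.\<close>

definition straight :: "nat \<Rightarrow> nat \<Rightarrow> (nat \<Rightarrow> int) \<Rightarrow> bool" where
  "straight K L v \<longleftrightarrow> (let n = K + L + 1 in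
     card {i. i < n \<and> 0 < v i} \<le> L \<and> card {i. i < n \<and> v i < 0} \<le> K \<and>
     (\<forall>e\<in>{1, -1}. \<forall>c\<ge>1. (\<exists>i<n. c \<le> e * v i) \<longrightarrow>
        (\<exists>i<n. \<exists>j<n. e * v i = c \<and> e * v j = c - 1 \<and> e * int j < e * int i)))"

text \<open>If \<open>v\<close> is not straight, either it has too many positive or negative entries, or some level \<open>c\<close> violates
  the condition on consecutive values. In the second case the relation for the set \<open>U\<close> of entries that are
  at least \<open>c\<close> expresses the derivative by smaller ones.\<close>

theorem Delta_deriv_in_span_straight:
  "Delta_deriv K L v \<in> poly_xy.span {Delta_deriv K L u | u. straight K L u}"
proof -
  define n where "n = K + L + 1"
  define sq where "sq v = (\<Sum>i\<in>{0..<n}. (v i)\<^sup>2)" for v :: "nat \<Rightarrow> int"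
  define mom where "mom v = (\<Sum>i\<in>{0..<n}. int i * v i)" for v :: "nat \<Rightarrow> int"
  have sq_nonneg: "0 \<le> sq v" for v unfolding sq_def by (rule sum_nonneg) simp
  have mom_le: "mom v \<le> int n * sq v" for v
    unfolding mom_def sq_def sum_distrib_left
  proof (rule sum_mono)
    fix i assume i: "i \<in> {0..<n}"
    have "v i \<le> (v i)\<^sup>2"
      by (cases "v i \<le> 0") (auto simp: power2_eq_square intro: order_trans[of _ 0] mult_le_cancel_left1[THEN iffD2])
    then have "int i * v i \<le> int i * (v i)\<^sup>2" by (rule mult_left_mono) simp
    also have "\<dots> \<le> int n * (v i)\<^sup>2" using i by (intro mult_right_mono) auto
    finally show "int i * v i \<le> int n * (v i)\<^sup>2" .
  qed
  \<comment> \<open>Smaller sum of squares, or the same sum of squares and larger moment. The bound on the moment turns the second alternative into a natural number.\<close>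
  define r where "r = measures [\<lambda>v. nat (sq v), \<lambda>v. nat (int n * sq v - mom v)]"
  have smaller: "(u, v) \<in> r" if "sq u < sq v \<or> sq u = sq v \<and> mom v < mom u" for u v
    using that sq_nonneg[of u] mom_le[of u] by (auto simp: r_def)
  have "wf r" by (simp add: r_def)
  then show ?thesis
  proof (induction v rule: wf_induct_rule)
    case (less v)
    show ?case
    proof (cases "straight K L v")
      case True
      then show ?thesis by (intro poly_xy.span_base) auto
    next
      case False
      then have "\<not> card {i. i < n \<and> 0 < v i} \<le> L \<or> \<not> card {i. i < n \<and> v i < 0} \<le> K \<or>
          (\<exists>e\<in>{1, -1}. \<exists>c\<ge>1. (\<exists>i<n. c \<le> e * v i) \<and>
            \<not> (\<exists>i<n. \<exists>j<n. e * v i = c \<and> e * v j = c - 1 \<and> e * int j < e * int i))"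
        unfolding straight_def Let_def n_def[symmetric] by meson
      then consider
          (pos) "card {i. i < n \<and> 0 < v i} > L" | (neg) "card {i. i < n \<and> v i < 0} > K"
        | (reduce) e c i0 where "e = 1 \<or> e = -1" "1 \<le> c" "i0 < n" "c \<le> e * v i0"
            "\<not> (\<exists>i<n. \<exists>j<n. e * v i = c \<and> e * v j = c - 1 \<and> e * int j < e * int i)"
        unfolding not_le by blast
      then show ?thesis
      proof cases
        case pos
        then have "Delta_deriv K L v = 0"
          using Delta_deriv_many_signs[of 1 L K v] by (simp add: n_def)
        then show ?thesis by (simp add: poly_xy.span_zero)
      next
        case neg
        then have "Delta_deriv K L v = 0"
          using Delta_deriv_many_signs[of "-1" L K v] by (simp add: n_def)
        then show ?thesis by (simp add: poly_xy.span_zero)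
      next
        case reduce
        note e = reduce(1)
        have e2: "e * e = 1" using e by auto
        define U where "U = {i\<in>{0..<n}. c \<le> e * v i}"
        \<comment> \<open>The relation is applied to \<open>v0\<close>; its summand for \<open>U' = U\<close> is the derivative encoded by \<open>v\<close>.\<close>
        define v0 where "v0 i = v i - (if i \<in> U then e else 0)" for i
        define w where "w U' i = v0 i + (if i \<in> U' then e else 0)" for U' i
        let ?S = "{U'. U' \<subseteq> {0..<n} \<and> card U' = card U \<and> (\<forall>i\<in>U'. 0 \<le> e * v0 i)}"
        have finS: "finite ?S" by (rule finite_subset[of _ "Pow {0..<n}"]) auto
        have "U \<noteq> {}" using reduce(3,4) by (auto simp: U_def)
        moreover have "finite U" by (simp add: U_def)
        ultimately have "0 < card U" by (simp add: card_gt_0_iff)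
        have ev0: "e * v0 i = e * v i - of_bool (i \<in> U)" for i
          by (simp add: v0_def right_diff_distrib e2)
        then have "U \<in> ?S" using reduce(2) by (auto simp: U_def)
        have "0 = (\<Sum>U'\<in>?S. Delta_deriv K L (w U'))"
          using sum_Delta_deriv_eq_0[OF e \<open>0 < card U\<close>, of K L v0] unfolding w_def n_def by simp
        also have "\<dots> = Delta_deriv K L (w U) + (\<Sum>U'\<in>?S - {U}. Delta_deriv K L (w U'))"
          by (rule sum.remove[OF finS \<open>U \<in> ?S\<close>])
        also have "w U = v" by (auto simp: w_def v0_def)
        finally have eq: "Delta_deriv K L v = - (\<Sum>U'\<in>?S - {U}. Delta_deriv K L (w U'))"
          by (simp add: eq_neg_iff_add_eq_0)
        have "Delta_deriv K L (w U') \<in> poly_xy.span {Delta_deriv K L u | u. straight K L u}"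
          if "U' \<in> ?S - {U}" for U'
        proof (rule less.IH, rule smaller)
          have ew: "e * w U' i = e * v i - of_bool (i \<in> U) + of_bool (i \<in> U')" for i
            by (simp add: w_def distrib_left ev0 e2)
          have e_sq: "(e * x)\<^sup>2 = x\<^sup>2" for x :: int using e by auto
          have e_mom: "e * int i * (e * x) = int i * x" for i x using e by auto
          have "(\<Sum>i\<in>{0..<n}. (e * w U' i)\<^sup>2) < (\<Sum>i\<in>{0..<n}. (e * v i)\<^sup>2) \<or>
            (\<Sum>i\<in>{0..<n}. (e * w U' i)\<^sup>2) = (\<Sum>i\<in>{0..<n}. (e * v i)\<^sup>2) \<and>
            (\<Sum>i\<in>{0..<n}. e * int i * (e * v i)) < (\<Sum>i\<in>{0..<n}. e * int i * (e * w U' i))"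
            unfolding ew
          proof (rule exchange_decreases[OF _ _ U_def])
            fix i j assume *: "i \<in> {0..<n}" "j \<in> {0..<n}" "e * v i = c" "e * v j = c - 1"
            then have "\<not> e * int j < e * int i"
              using reduce(5) by (metis atLeastLessThan_iff)
            moreover have "i \<noteq> j" using * by auto
            ultimately show "e * int i < e * int j" using e by auto
          qed (use that in auto)
          then show "sq (w U') < sq v \<or> sq (w U') = sq v \<and> mom v < mom (w U')"
            unfolding e_sq e_mom sq_def mom_def .
        qed
        then show ?thesis
          unfolding eq by (intro poly_xy.span_neg poly_xy.span_sum)
      qed
    qed
  qed
qed


section \<open>Straight vectors and permutations\<close>

text \<open>The key orders places by decreasing value of \<open>v\<close> and, among equal values, by increasing index: the index
  is below \<open>n\<close>, so it cannot outweigh a difference of the values.\<close>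

definition sorted_places :: "nat \<Rightarrow> (nat \<Rightarrow> int) \<Rightarrow> nat list" where
  "sorted_places n v = sort_key (\<lambda>i. - v i * int n + int i) [0..<n]"

lemma sorted_places_simps [simp]:
  "set (sorted_places n v) = {0..<n}" "distinct (sorted_places n v)" "length (sorted_places n v) = n"
  by (simp_all add: sorted_places_def)

lemma sorted_places_order:
  fixes v :: "nat \<Rightarrow> int" and n k l :: nat
  assumes "k < l" "l < n"
  defines "xs \<equiv> sorted_places n v"
  shows "v (xs ! l) < v (xs ! k) \<or> v (xs ! l) = v (xs ! k) \<and> xs ! k < xs ! l"
proof -
  let ?key = "\<lambda>i. - v i * int n + int i"
  have "sorted (map ?key xs)" by (simp add: xs_def sorted_places_def)
  then have le: "?key (xs ! k) \<le> ?key (xs ! l)"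
    using assms by (simp add: sorted_iff_nth_mono)
  have n: "xs ! k < n" "xs ! l < n"
    using assms nth_mem[of k xs] nth_mem[of l xs] by (simp_all add: xs_def)
  have neq: "xs ! k \<noteq> xs ! l"
    using assms by (simp add: xs_def nth_eq_iff_index_eq)
  have "\<not> v (xs ! k) < v (xs ! l)"
  proof
    assume "v (xs ! k) < v (xs ! l)"
    then have "(v (xs ! k) + 1) * int n \<le> v (xs ! l) * int n"
      by (intro mult_right_mono) simp_all
    then show False using le n by (simp add: distrib_right)
  qed
  then show ?thesis using le neq by (cases "v (xs ! k) = v (xs ! l)") auto
qed

text \<open>Let \<open>i\<close> and \<open>j\<close> be neighbours in sorted order. If their values differ, straightness provides an
  occurrence of the larger of two consecutive values to the right of an occurrence of the smaller. Since
  nothing lies between \<open>i\<close> and \<open>j\<close> in sorted order, the two values must be those of \<open>i\<close> and \<open>j\<close>, and the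
  order within a block of equal values yields \<open>j < i\<close>. Equal values are sorted by index.\<close>

lemma straight_steps:
  fixes v :: "nat \<Rightarrow> int" and K L k :: nat
  assumes v: "straight K L v" and k: "Suc k < K + L + 1"
  defines "xs \<equiv> sorted_places (K + L + 1) v"
  shows "v (xs ! k) - v (xs ! Suc k) = of_bool (xs ! Suc k < xs ! k)"
proof -
  define n where "n = K + L + 1"
  define i where "i = xs ! k"
  define j where "j = xs ! Suc k"
  have step: "\<exists>i1<n. \<exists>i0<n. e * v i1 = c \<and> e * v i0 = c - 1 \<and> e * int i0 < e * int i1"
    if "e = 1 \<or> e = -1" "1 \<le> c" "\<exists>i<n. c \<le> e * v i" for e c
    using v that unfolding straight_def Let_def n_def by blast
  have ij: "i < n" "j < n"
    using k nth_mem[of k xs] nth_mem[of "Suc k" xs] by (simp_all add: xs_def i_def j_def n_def)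
  have order: "v j < v i \<or> v j = v i \<and> i < j"
    using sorted_places_order[of k "Suc k" n v] k by (simp add: xs_def i_def j_def n_def)
  have side: "(v i < v l \<or> v i = v l \<and> l \<le> i) \<or> (v l < v j \<or> v l = v j \<and> j \<le> l)" if "l < n" for l
  proof -
    have "l \<in> set xs" "length xs = n" using that by (simp_all add: xs_def n_def)
    then obtain q where q: "q < n" "l = xs ! q"
      by (metis in_set_conv_nth)
    consider "q < k" | "q = k" | "q = Suc k" | "Suc k < q" by linarith
    then show ?thesis
    proof cases
      case 1
      then show ?thesis
        using sorted_places_order[of q k n v] k q by (auto simp: xs_def i_def n_def)
    next
      case 4
      then show ?thesis
        using sorted_places_order[of "Suc k" q n v] q by (auto simp: xs_def j_def n_def)
    qed (use q in \<open>auto simp: i_def j_def\<close>)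
  qed
  show ?thesis
  proof (cases "v i = v j")
    case True
    then show ?thesis using order by (simp add: i_def j_def)
  next
    case False
    then have less: "v j < v i" using order by simp
    have "v i = v j + 1 \<and> j < i"
    proof (cases "1 \<le> v i")
      case True
      then obtain i1 i0 where *: "i1 < n" "i0 < n" "v i1 = v i" "v i0 = v i - 1" "i0 < i1"
        using step[of 1 "v i"] ij by auto
      then show ?thesis using side[OF *(1)] side[OF *(2)] less by linarith
    next
      case False
      have "\<exists>i1<n. \<exists>i0<n. -1 * v i1 = - v j \<and> -1 * v i0 = - v j - 1 \<and> -1 * int i0 < -1 * int i1"
        by (rule step) (use ij False less in auto)
      then obtain i1 i0 where *: "i1 < n" "i0 < n" "-1 * v i1 = - v j" "-1 * v i0 = - v j - 1"
          "-1 * int i0 < -1 * int i1"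
        by blast
      then show ?thesis using side[OF *(1)] side[OF *(2)] less by linarith
    qed
    then show ?thesis by (simp add: i_def j_def)
  qed
qed

text \<open>At most \<open>L\<close> entries are positive and at most \<open>K\<close> of the \<open>K + L + 1\<close> entries are negative.\<close>

lemma straight_zero:
  assumes "straight K L v"
  shows "v (sorted_places (K + L + 1) v ! L) = 0"
proof -
  define n where "n = K + L + 1"
  define xs where "xs = sorted_places n v"
  have card: "card {i. i < n \<and> 0 < v i} \<le> L" "card {i. i < n \<and> v i < 0} \<le> K"
    using assms unfolding straight_def Let_def n_def by auto
  have inj: "inj_on (\<lambda>q. xs ! q) Q" if "Q \<subseteq> {..<n}" for Q
    by (rule inj_on_nth) (use that in \<open>auto simp: xs_def\<close>)
  have mono: "v (xs ! l) \<le> v (xs ! k)" if "k \<le> l" "l < n" for k l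
    using sorted_places_order[of k l n v] that by (cases "k = l") (auto simp: xs_def)
  have lt: "xs ! q < n" if "q < n" for q
    using nth_mem[of q xs] that by (simp add: xs_def)
  have "\<not> 0 < v (xs ! L)"
  proof
    assume pos: "0 < v (xs ! L)"
    have "(\<lambda>q. xs ! q) ` {..L} \<subseteq> {i. i < n \<and> 0 < v i}"
    proof safe
      fix q assume "q \<le> L"
      then show "xs ! q < n" "0 < v (xs ! q)"
        using lt[of q] mono[of q L] pos by (auto simp: n_def)
    qed
    then have "card ((\<lambda>q. xs ! q) ` {..L}) \<le> L"
      by (intro order_trans[OF card_mono card(1)]) simp_all
    then show False using inj[of "{..L}"] by (simp add: card_image n_def subset_eq)
  qed
  moreover have "\<not> v (xs ! L) < 0"
  proof
    assume neg: "v (xs ! L) < 0"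
    have "(\<lambda>q. xs ! q) ` {L..<n} \<subseteq> {i. i < n \<and> v i < 0}"
    proof safe
      fix q assume "q \<in> {L..<n}"
      then show "xs ! q < n" "v (xs ! q) < 0"
        using lt[of q] mono[of L q] neg by auto
    qed
    then have "card ((\<lambda>q. xs ! q) ` {L..<n}) \<le> K"
      by (intro order_trans[OF card_mono card(2)]) simp_all
    then show False using inj[of "{L..<n}"] by (simp add: card_image n_def subset_eq)
  qed
  ultimately show ?thesis by (simp add: xs_def n_def)
qed

text \<open>The sorting permutation fixes all differences of consecutive sorted values, and the value \<open>0\<close> at
  position \<open>L\<close> fixes the additive constant.\<close>

lemma straight_determined:
  assumes v: "straight K L v" and w: "straight K L w"
    and eq: "sorted_places (K + L + 1) v = sorted_places (K + L + 1) w" and i: "i < K + L + 1"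
  shows "v i = w i"
proof -
  define n where "n = K + L + 1"
  define xs where "xs = sorted_places n v"
  have xs: "xs = sorted_places n w" using eq by (simp add: xs_def n_def)
  have diff: "v (xs ! k) - w (xs ! k) = v (xs ! 0) - w (xs ! 0)" if "k < n" for k
    using that
  proof (induction k)
    case (Suc k)
    have "v (xs ! k) - v (xs ! Suc k) = w (xs ! k) - w (xs ! Suc k)"
      using straight_steps[OF v, of k] straight_steps[OF w, of k] Suc.prems xs
      by (simp add: xs_def n_def)
    then show ?case using Suc by simp
  qed simp
  have "v (xs ! L) - w (xs ! L) = 0"
    using straight_zero[OF v] straight_zero[OF w] xs by (simp add: xs_def n_def)
  moreover have "L < n" by (simp add: n_def)
  moreover obtain k where "k < n" "i = xs ! k"
  proof -
    have "i \<in> set xs" "length xs = n" using i by (simp_all add: xs_def n_def)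
    then show thesis using that by (metis in_set_conv_nth)
  qed
  ultimately show ?thesis using diff[of L] diff[of k] by simp
qed

lemma straight_restrict:
  "straight K L v \<Longrightarrow> straight K L (\<lambda>i. if i < K + L + 1 then v i else 0)"
  unfolding straight_def Let_def by (simp cong: conj_cong)

lemma card_straight_derivs:
  fixes K L :: nat
  defines "C \<equiv> {Delta_deriv K L u | u. straight K L u}"
  shows "finite C" "card C \<le> fact (K + L + 1)"
proof -
  let ?n = "K + L + 1"
  define S where "S = {u. straight K L u \<and> (\<forall>i\<ge>?n. u i = 0)}"
  have "inj_on (sorted_places ?n) S"
  proof (rule inj_onI)
    fix v w assume *: "v \<in> S" "w \<in> S" "sorted_places ?n v = sorted_places ?n w"
    have "v i = w i" for i
      using straight_determined[of K L v w i] * by (cases "i < ?n") (auto simp: S_def not_less)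
    then show "v = w" by blast
  qed
  moreover have sub: "sorted_places ?n ` S \<subseteq> permutations_of_set {0..<?n}"
    by (auto simp: permutations_of_set_def simp del: One_nat_def add_Suc_right)
  ultimately have S: "finite S" "card S \<le> fact ?n"
    using inj_on_finite[of "sorted_places ?n" S] card_inj_on_le[of "sorted_places ?n" S "permutations_of_set {0..<?n}"]
    by auto
  have "C \<subseteq> Delta_deriv K L ` S"
  proof
    fix p assume "p \<in> C"
    then obtain u where u: "straight K L u" "p = Delta_deriv K L u" by (auto simp: C_def)
    have "p = Delta_deriv K L (\<lambda>i. if i < ?n then u i else 0)"
      unfolding u(2) by (rule Delta_deriv_cong) simp
    moreover have "(\<lambda>i. if i < ?n then u i else 0) \<in> S"
      using straight_restrict[OF u(1)] by (simp add: S_def)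
    ultimately show "p \<in> Delta_deriv K L ` S" by blast
  qed
  then show "finite C" "card C \<le> fact ?n"
    using S surj_card_le[of S C "Delta_deriv K L"] finite_subset by (blast, force)
qed

theorem M_hook_subset_span:
  "M (hook K L) \<subseteq> poly_xy.span {Delta_deriv K L u | u. straight K L u}"
  unfolding M_def sum_list_hook
proof (rule poly_xy.span_minimal, rule subsetI)
  let ?n = "K + L + 1"
  fix p assume "p \<in> {pderivs vs (Delta (hook K L)) | vs. set vs \<subseteq> vars ?n}"
  then obtain vs where vs: "set vs \<subseteq> vars ?n" "p = pderivs vs (Delta (hook K L))" by auto
  show "p \<in> poly_xy.span {Delta_deriv K L u | u. straight K L u}"
  proof (cases "\<exists>i<?n. X (Suc i) \<in> set vs \<and> Y (Suc i) \<in> set vs")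
    case True
    then obtain i where i: "i < ?n" "X (Suc i) \<in> set vs" "Y (Suc i) \<in> set vs" by blast
    have "p = 0"
    proof (rule poly_mapping_eqI)
      fix m
      have "Poly_Mapping.lookup (Delta (hook K L)) (m + exponents vs) = 0"
        by (rule lookup_Delta_both_axes[of 1 i])
          (use i in \<open>auto simp: axis_def lookup_add lookup_exponents count_list_0_iff\<close>)
      then have "factorials m * Poly_Mapping.lookup p m = 0"
        unfolding vs(2) lookup_pderivs by simp
      then show "Poly_Mapping.lookup p m = Poly_Mapping.lookup 0 m" by simp
    qed
    then show ?thesis by (simp add: poly_xy.span_zero)
  next
    case False
    define v where "v i = int (count_list vs (X (Suc i))) - int (count_list vs (Y (Suc i)))" for i
    have "exponents vs = vec_monomial ?n v"
      unfolding eq_vec_monomial_iff[of 1, simplified]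
    proof (intro conjI allI impI)
      fix x assume "x \<notin> vars ?n"
      then show "Poly_Mapping.lookup (exponents vs) x = 0"
        using vs(1) by (auto simp: lookup_exponents count_list_0_iff)
    next
      fix i assume "i < ?n"
      then have "count_list vs (X (Suc i)) = 0 \<or> count_list vs (Y (Suc i)) = 0"
        using False by (auto simp: count_list_0_iff)
      then show "Poly_Mapping.lookup (exponents vs) (axis 1 i) = nat (v i)"
        "Poly_Mapping.lookup (exponents vs) (axis (- 1) i) = nat (- v i)"
        by (auto simp: lookup_exponents axis_def v_def)
    qed
    then have "p = Delta_deriv K L v"
      unfolding vs(2) by (intro pderivs_cong_exponents) (simp add: exponents_var_list)
    then show ?thesis using Delta_deriv_in_span_straight by simp
  qed
qed (rule poly_xy.subspace_span)

section \<open>Drawings by recursion on the leftmost column\<close>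

definition ncols :: "coltype \<Rightarrow> drawing \<Rightarrow> nat" where
  "ncols t D = length (filter (\<lambda>c. fst c = t) D)"

lemma ncols_simps [simp]:
  "ncols t [] = 0"
  "ncols t ((t', a) # D) = (if t' = t then Suc (ncols t D) else ncols t D)"
  by (simp_all add: ncols_def)

lemma length_eq_ncols: "length D = ncols XCol D + ncols YCol D"
proof (induction D)
  case (Cons c D)
  then show ?case by (cases c; cases "fst c") auto
qed simp

text \<open>The colour of the first uniform \<open>x\<close>-column of a drawing.\<close>

datatype shade = Absent | White | Crossed

fun first_uniform :: "drawing \<Rightarrow> shade" where
  "first_uniform [] = Absent"
| "first_uniform ((YCol, b) # D) = first_uniform D"
| "first_uniform ((XCol, a) # D) =
     (if a = 0 then White else if a = Suc (ncols XCol D) then Crossed else first_uniform D)"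

text \<open>The rules for drawings, read from left to right. Columns of one type have depths decreasing to \<open>1\<close>, so the
  depth of the leftmost column is one more than the number of columns of its type to its right, and the
  rule for a \<open>y\<close>-column depends on the drawing to its right only through \<open>first_uniform\<close>.\<close>

fun admissible :: "drawing \<Rightarrow> bool" where
  "admissible [] \<longleftrightarrow> True"
| "admissible ((XCol, a) # D) \<longleftrightarrow> a \<le> Suc (ncols XCol D) \<and> admissible D"
| "admissible ((YCol, b) # D) \<longleftrightarrow> b \<le> Suc (ncols YCol D) \<and>
     (first_uniform D = White \<longrightarrow> b \<noteq> 0) \<and> (first_uniform D = Crossed \<longrightarrow> b \<noteq> Suc (ncols YCol D)) \<and>
     admissible D"

text \<open>An \<open>x\<close>-column of depth \<open>1\<close> is always uniform.\<close>

lemma first_uniform_Absent_iff: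
  "admissible D \<Longrightarrow> first_uniform D = Absent \<longleftrightarrow> ncols XCol D = 0"
proof (induction D rule: admissible.induct)
  case (2 a D)
  then show ?case by (cases "a = 0"; cases "ncols XCol D") auto
qed auto

definition admissible_drawings :: "nat \<Rightarrow> nat \<Rightarrow> drawing set" where
  "admissible_drawings K L = {D. admissible D \<and> ncols YCol D = K \<and> ncols XCol D = L}"

lemma drawing_cases:
  obtains "D = []" | a R where "D = (XCol, a) # R" | b R where "D = (YCol, b) # R"
proof (cases D)
  case (Cons c R)
  then show thesis using that by (cases c; cases "fst c") auto
qed (use that in blast)

definition y_choices :: "nat \<Rightarrow> drawing \<Rightarrow> nat set" where
  "y_choices K R = {..K} - (if first_uniform R = White then {0} else {})
     - (if first_uniform R = Crossed then {K} else {})"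

lemma admissible_drawings_unfold:
  "admissible_drawings K L =
     (if K = 0 \<and> L = 0 then {[]} else {}) \<union>
     (if L = 0 then {} else (\<lambda>(a, R). (XCol, a) # R) ` ({..L} \<times> admissible_drawings K (L - 1))) \<union>
     (if K = 0 then {} else
        (\<lambda>(R, b). (YCol, b) # R) ` (SIGMA R : admissible_drawings (K - 1) L. y_choices K R))"
  (is "_ = ?rhs")
proof (rule Set.set_eqI)
  fix D show "D \<in> admissible_drawings K L \<longleftrightarrow> D \<in> ?rhs"
    by (cases D rule: drawing_cases)
      (auto simp: admissible_drawings_def y_choices_def image_iff split: if_splits)
qed

text \<open>The leftmost column is either an \<open>x\<close>-column with \<open>L + 1\<close> choices, or a \<open>y\<close>-column with \<open>K\<close> choices if
  there is an \<open>x\<close>-column to its right, as the rule forbids exactly one number of crosses, and \<open>K + 1\<close>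
  choices otherwise. In total this multiplies the number of drawings with one place less by \<open>K + L + 1\<close>.\<close>

lemma card_admissible_drawings:
  "finite (admissible_drawings K L) \<and> card (admissible_drawings K L) = fact (K + L + 1)"
proof (induction "K + L" arbitrary: K L)
  case 0
  then show ?case by (subst (1 2) admissible_drawings_unfold) simp
next
  case (Suc n)
  let ?x = "if L = 0 then {} else (\<lambda>(a, R). (XCol, a) # R) ` ({..L} \<times> admissible_drawings K (L - 1))"
  let ?y = "if K = 0 then {} else
        (\<lambda>(R, b). (YCol, b) # R) ` (SIGMA R : admissible_drawings (K - 1) L. y_choices K R)"
  have x: "finite ?x \<and> card ?x = (if L = 0 then 0 else (L + 1) * fact (K + L))"
  proof (cases "L = 0")
    case False
    then have "finite (admissible_drawings K (L - 1))" "card (admissible_drawings K (L - 1)) = fact (K + L)"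
      using Suc(1)[of K "L - 1"] Suc(2) by auto
    then show ?thesis
      using False by (auto simp: inj_on_def card_image card_cartesian_product)
  qed simp
  have y: "finite ?y \<and> card ?y = (if K = 0 then 0 else (if L = 0 then K + 1 else K) * fact (K + L))"
  proof (cases "K = 0")
    case False
    have fin: "finite (admissible_drawings (K - 1) L)" "card (admissible_drawings (K - 1) L) = fact (K + L)"
      using Suc(1)[of "K - 1" L] Suc(2) False by auto
    have "card (y_choices K R) = (if L = 0 then K + 1 else K)" if "R \<in> admissible_drawings (K - 1) L" for R
      using that False first_uniform_Absent_iff[of R]
      by (cases "first_uniform R") (auto simp: y_choices_def admissible_drawings_def)
    moreover have "finite (y_choices K R)" for R by (simp add: y_choices_def)
    ultimately have "finite (SIGMA R : admissible_drawings (K - 1) L. y_choices K R)"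
      "card (SIGMA R : admissible_drawings (K - 1) L. y_choices K R) = (if L = 0 then K + 1 else K) * fact (K + L)"
      using fin by (auto simp: card_SigmaI)
    then show ?thesis
      using False by (auto simp: inj_on_def card_image)
  qed simp
  have "admissible_drawings K L = ?x \<union> ?y"
    using Suc(2) by (subst admissible_drawings_unfold) auto
  moreover have "?x \<inter> ?y = {}" by auto
  ultimately have "card (admissible_drawings K L) = card ?x + card ?y" "finite (admissible_drawings K L)"
    using x y card_Un_disjoint[of ?x ?y] by auto
  moreover have "(if L = 0 then 0 else (L + 1) * fact (K + L)) +
      (if K = 0 then 0 else (if L = 0 then K + 1 else K) * fact (K + L)) = (fact (K + L + 1) :: nat)"
    using Suc(2) by (auto simp: algebra_simps)
  ultimately show ?case
    using x y by simp
qed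

lemma card_columns_before:
  assumes "i \<le> length D"
  shows "card {j. j < i \<and> fst (D ! j) = t} = ncols t (take i D)"
proof -
  have "ncols t (take i D) = card {j. j < length (take i D) \<and> fst (take i D ! j) = t}"
    unfolding ncols_def by (rule length_filter_conv_card)
  also have "{j. j < length (take i D) \<and> fst (take i D ! j) = t} = {j. j < i \<and> fst (D ! j) = t}"
    using assms by auto
  finally show ?thesis ..
qed

lemma height_eq:
  assumes "D \<in> admissible_drawings K L" "i < length D"
  shows "height K L D i = Suc (ncols (kind D i) (drop (Suc i) D))"
proof -
  have "ncols t D = ncols t (take i D) + ncols t (drop i D)" for t
    unfolding ncols_def by (metis append_take_drop_id filter_append length_append)
  moreover have "drop i D = D ! i # drop (Suc i) D"
    using assms(2) by (simp add: Cons_nth_drop_Suc)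
  ultimately have "ncols (kind D i) D = ncols (kind D i) (take i D) + Suc (ncols (kind D i) (drop (Suc i) D))"
    by (cases "D ! i") simp
  moreover have "ncols (kind D i) D = (case kind D i of YCol \<Rightarrow> K | XCol \<Rightarrow> L)"
    using assms(1) by (auto simp: admissible_drawings_def split: coltype.split)
  ultimately show ?thesis
    using card_columns_before[of i D "kind D i"] assms(2) by (simp add: height_def)
qed

lemma admissible_drop: "admissible D \<Longrightarrow> admissible (drop i D)"
proof (induction D arbitrary: i rule: admissible.induct)
  case (2 a D)
  then show ?case by (cases i) auto
next
  case (3 b D)
  then show ?case by (cases i) auto
qed auto

lemma first_uniform_drop:
  assumes D: "D \<in> admissible_drawings K L"
    and "i \<le> j" "j < length D" "uniform_xcol K L D j" "\<forall>k. i \<le> k \<and> k < j \<longrightarrow> \<not> uniform_xcol K L D k"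
  shows "first_uniform (drop i D) = (if white_xcol D j then White else Crossed)"
  using assms(2-)
proof (induction rule: inc_induct)
  case base
  have "drop j D = D ! j # drop (Suc j) D"
    using base by (simp add: Cons_nth_drop_Suc)
  then show ?case
    using base height_eq[OF D, of j]
    by (cases "D ! j") (auto simp: uniform_xcol_def white_xcol_def crossed_xcol_def)
next
  case (step k)
  then have k: "k < length D" "\<not> uniform_xcol K L D k"
    by auto
  have "drop k D = D ! k # drop (Suc k) D"
    using k by (simp add: Cons_nth_drop_Suc)
  then have "first_uniform (drop k D) = first_uniform (drop (Suc k) D)"
    using k height_eq[OF D, of k]
    by (cases "D ! k"; cases "kind D k") (auto simp: uniform_xcol_def white_xcol_def crossed_xcol_def)
  then show ?case
    using step by auto
qed

lemma admissible_drawings_subset: "admissible_drawings K L \<subseteq> drawings K L"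
proof
  fix D assume D: "D \<in> admissible_drawings K L"
  have cols: "card {i. i < length D \<and> kind D i = t} = ncols t D" for t
    using card_columns_before[of "length D" D t] by simp
  have adm: "admissible (D ! i # drop (Suc i) D)" if "i < length D" for i
    using that D admissible_drop[of D i] by (simp add: admissible_drawings_def Cons_nth_drop_Suc)
  show "D \<in> drawings K L"
    unfolding drawings_def mem_Collect_eq
  proof (intro conjI allI impI)
    show "length D = K + L"
      using D length_eq_ncols[of D] by (simp add: admissible_drawings_def)
    show "card {i. i < length D \<and> kind D i = YCol} = K" "card {i. i < length D \<and> kind D i = XCol} = L"
      using D by (simp_all add: cols admissible_drawings_def)
  next
    fix i assume "i < length D"
    then show "crosses D i \<le> height K L D i"
      using adm[of i] height_eq[OF D, of i] by (cases "D ! i"; cases "kind D i") auto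
  next
    fix i j
    assume i: "i < length D" and j: "kind D i = YCol \<and> first_uniform_right K L D i j"
    have *: "first_uniform (drop (Suc i) D) = (if white_xcol D j then White else Crossed)"
      using j by (intro first_uniform_drop[OF D]) (auto simp: first_uniform_right_def)
    { assume "white_xcol D j"
      then show "1 \<le> crosses D i"
        using * adm[OF i] j by (cases "D ! i") auto }
    { assume crossed: "crossed_xcol K L D j"
      then have "\<not> white_xcol D j"
        using height_eq[OF D, of j] j by (auto simp: crossed_xcol_def white_xcol_def first_uniform_right_def)
      then show "crosses D i < height K L D i"
        using * adm[OF i] height_eq[OF D i] j by (cases "D ! i") auto }
  qed
qed

section \<open>The pairing between drawings\<close>

text \<open>This is the exponent of \<open>x\<close> (for \<open>XCol\<close>) or of \<open>y\<close> (for \<open>YCol\<close>) at the place of the column.\<close>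

fun crosses_of :: "coltype \<Rightarrow> coltype \<times> nat \<Rightarrow> nat" where
  "crosses_of t (t', a) = (if t = t' then a else 0)"

fun complement :: "drawing \<Rightarrow> drawing" where
  "complement [] = []"
| "complement ((t, a) # D) = (t, Suc (ncols t D) - a) # complement D"

text \<open>The numbers in \<open>zs\<close> describe a term of the determinant as in \<open>hook_val\<close>, and the crosses of \<open>D\<close> and \<open>E\<close>
  together form it.\<close>

definition fits :: "int list \<Rightarrow> drawing \<Rightarrow> drawing \<Rightarrow> bool" where
  "fits zs D E \<longleftrightarrow> length D = length zs \<and> length E = length zs \<and>
     (\<forall>i < length zs. crosses_of XCol (D ! i) + crosses_of XCol (E ! i) = nat (zs ! i) \<and>
                      crosses_of YCol (D ! i) + crosses_of YCol (E ! i) = nat (- (zs ! i)))"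

lemma fits_Cons:
  "fits zs (c # D) (d # E) \<longleftrightarrow> (\<exists>z zs'. zs = z # zs' \<and> fits zs' D E \<and>
     crosses_of XCol c + crosses_of XCol d = nat z \<and>
     crosses_of YCol c + crosses_of YCol d = nat (- z))"
proof (cases zs)
  case (Cons z zs')
  show ?thesis
    unfolding Cons fits_def by (auto simp: nth_Cons' All_less_Suc2)
qed (auto simp: fits_def)

text \<open>For offsets \<open>0\<close> this is the relation \<open>D \<rightarrow> E\<close>: the crosses of \<open>D\<close> and the white cells of \<open>E\<close> together form
  a term of the determinant of the hook to which \<open>E\<close> belongs. When the first columns are removed from two
  drawings, they may be of different types, and the rest of the term then belongs to the hook of neither
  remainder in a uniform way. The integer offsets record the discrepancy: the term has \<open>\<kappa>\<close> places with powers
  of \<open>y\<close>, where \<open>\<kappa>\<close> is the number of \<open>y\<close>-columns of the target corrected by the difference of the offsets.\<close>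

definition step :: "drawing \<times> int \<Rightarrow> drawing \<times> int \<Rightarrow> bool" where
  "step P Q \<longleftrightarrow> (\<exists>zs \<kappa>. \<kappa> = int (ncols YCol (fst Q)) + snd Q - snd P \<and>
     fits zs (fst P) (complement (fst Q)) \<and> distinct zs \<and>
     set zs = {- \<kappa> .. int (length (fst P)) - \<kappa>} - {0})"

text \<open>A step can be restricted to the remainders if the exponent \<open>z\<close> at the first place is extremal, since only
  then do the other exponents fill a shorter interval; the last two conclusions compute which offsets
  \<open>r, r'\<close> are correct afterwards.\<close>

lemma step_Cons:
  assumes "step ((t, a) # R, s) ((t', a') # R', s')"
  defines "\<kappa> \<equiv> int (ncols YCol ((t', a') # R')) + s' - s"
  defines "w \<equiv> Suc (ncols t' R') - a'"
  obtains z where "- \<kappa> \<le> z" "z \<le> int (length R) + 1 - \<kappa>" "z \<noteq> 0"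
    "crosses_of XCol (t, a) + crosses_of XCol (t', w) = nat z"
    "crosses_of YCol (t, a) + crosses_of YCol (t', w) = nat (- z)"
    "\<And>r r'. z = int (length R) + 1 - \<kappa> \<Longrightarrow> z > 0 \<Longrightarrow> int (ncols YCol R') + r' - r = \<kappa> \<Longrightarrow> step (R, r) (R', r')"
    "\<And>r r'. z = - \<kappa> \<Longrightarrow> z < 0 \<Longrightarrow> int (ncols YCol R') + r' - r = \<kappa> - 1 \<Longrightarrow> step (R, r) (R', r')"
proof -
  from assms(1) obtain zs where zs: "fits zs ((t, a) # R) ((t', w) # complement R')" "distinct zs"
     and set_zs: "set zs = {- \<kappa> .. int (Suc (length R)) - \<kappa>} - {0}"
    unfolding step_def \<kappa>_def w_def fst_conv snd_conv complement.simps list.size(4) add_Suc_right add_0_right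
    by metis
  from zs(1) obtain z zs' where z: "zs = z # zs'" "fits zs' R (complement R')"
     "crosses_of XCol (t, a) + crosses_of XCol (t', w) = nat z"
     "crosses_of YCol (t, a) + crosses_of YCol (t', w) = nat (- z)"
    unfolding fits_Cons by auto
  have "set zs' = set zs - {z}"
    using zs(2) unfolding z(1) by simp
  then have set: "set zs' = {- \<kappa> .. int (Suc (length R)) - \<kappa>} - {0} - {z}"
    unfolding set_zs .
  have "z \<in> set zs"
    unfolding z(1) by simp
  then have zin: "z \<in> {- \<kappa> .. int (Suc (length R)) - \<kappa>} - {0}"
    unfolding set_zs .
  show ?thesis
  proof (rule that[of z])
    fix r r' assume "z = int (length R) + 1 - \<kappa>" "z > 0" "int (ncols YCol R') + r' - r = \<kappa>"
    moreover from this have "set zs' = {- \<kappa> .. int (length R) - \<kappa>} - {0}"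
      unfolding set by auto
    ultimately show "step (R, r) (R', r')"
      unfolding step_def fst_conv snd_conv using z(2) zs(2) z(1) by (metis distinct.simps(2))
  next
    fix r r' assume "z = - \<kappa>" "z < 0" "int (ncols YCol R') + r' - r = \<kappa> - 1"
    moreover from this have "set zs' = {- (\<kappa> - 1) .. int (length R) - (\<kappa> - 1)} - {0}"
      unfolding set by auto
    ultimately show "step (R, r) (R', r')"
      unfolding step_def fst_conv snd_conv using z(2) zs(2) z(1) by (metis distinct.simps(2))
  qed (use zin z in auto)
qed


text \<open>For an \<open>x\<close>-column with \<open>a\<close> crosses put \<open>\<alpha> = a - s\<close>, for a \<open>y\<close>-column with \<open>b\<close> crosses put \<open>\<beta> = b + s\<close>,
  where \<open>s\<close> is the offset. The bounds on the exponent at the first place become inequalities between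
  \<open>\<alpha>\<close>, \<open>\<beta>\<close> and their successors along a step. Equality says that the exponent is extremal, so
  that the step restricts to the remainders. This lemma and the next three treat the four
  combinations of types. If the types differ, one of the two columns must contribute nothing to the
  first place, because no term has powers of both \<open>x\<close> and \<open>y\<close> there.\<close>

lemma step_XX:
  assumes "step ((XCol, a) # R, s) ((XCol, a') # R', s')" "a' \<le> Suc (ncols XCol R')"
    "length R' = length R"
  shows "int a - s \<le> int a' - s'"
    and "int a - s = int a' - s' \<Longrightarrow> r' - r = s' - s \<Longrightarrow> step (R, r) (R', r')"
proof -
  let ?k = "int (ncols YCol R') + s' - s"
  have len: "int (length R) = int (ncols XCol R') + int (ncols YCol R')"
    using assms(3) length_eq_ncols[of R'] by simp
  from assms(1) obtain z where z: "z \<le> int (length R) + 1 - ?k"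
     "z \<noteq> 0" "a + (Suc (ncols XCol R') - a') = nat z" "0 = nat (- z)"
    and st: "\<And>r r'. z = int (length R) + 1 - ?k \<Longrightarrow> z > 0 \<Longrightarrow>
       int (ncols YCol R') + r' - r = ?k \<Longrightarrow> step (R, r) (R', r')"
    by (rule step_Cons) simp
  have pos: "z > 0" using z(2,4) by simp
  have eq: "z = int a + (int (ncols XCol R') + 1 - int a')"
    using z(3) pos assms(2) by (simp add: of_nat_diff eq_nat_nat_iff nat_eq_iff2)
  show "int a - s \<le> int a' - s'" using z(1) unfolding eq len by simp
  assume "int a - s = int a' - s'" "r' - r = s' - s"
  then show "step (R, r) (R', r')" using pos by (intro st) (simp_all add: eq len)
qed

lemma step_YY:
  assumes "step ((YCol, b) # R, s) ((YCol, b') # R', s')" "b' \<le> Suc (ncols YCol R')"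
    "length R' = length R"
  shows "int b + s \<le> int b' + s'"
    and "int b + s = int b' + s' \<Longrightarrow> r' - r = s' - s \<Longrightarrow> step (R, r) (R', r')"
proof -
  let ?k = "int (Suc (ncols YCol R')) + s' - s"
  from assms(1) obtain z where z: "- ?k \<le> z"
     "z \<noteq> 0" "0 = nat z" "b + (Suc (ncols YCol R') - b') = nat (- z)"
    and st: "\<And>r r'. z = - ?k \<Longrightarrow> z < 0 \<Longrightarrow>
       int (ncols YCol R') + r' - r = ?k - 1 \<Longrightarrow> step (R, r) (R', r')"
    by (rule step_Cons) simp
  have neg: "z < 0" using z(2,3) by simp
  have eq: "z = - (int b + (int (ncols YCol R') + 1 - int b'))"
    using z(4) neg assms(2) by (simp add: of_nat_diff nat_eq_iff2)
  show "int b + s \<le> int b' + s'" using z(1) unfolding eq by simp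
  assume "int b + s = int b' + s'" "r' - r = s' - s"
  then show "step (R, r) (R', r')" using neg by (intro st) (simp_all add: eq)
qed

lemma step_XY:
  assumes "step ((XCol, a) # R, s) ((YCol, b') # R', s')" "b' \<le> Suc (ncols YCol R')"
    "length R' = length R"
  obtains (zero) "a = 0" "b' < Suc (ncols YCol R')" "s \<le> int b' + s'"
      "\<And>r r'. s = int b' + s' \<Longrightarrow> r' - r = s' - s \<Longrightarrow> step (R, r) (R', r')"
  | (full) "0 < a" "b' = Suc (ncols YCol R')"
      "int a - s \<le> int (ncols XCol R') - s'"
      "\<And>r r'. int a - s = int (ncols XCol R') - s' \<Longrightarrow> r' - r = s' - s + 1 \<Longrightarrow> step (R, r) (R', r')"
proof -
  have len: "int (length R) = int (ncols XCol R') + int (ncols YCol R')"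
    using assms(3) length_eq_ncols[of R'] by simp
  let ?k = "int (Suc (ncols YCol R')) + s' - s"
  from assms(1) obtain z where z: "- ?k \<le> z" "z \<le> int (length R) + 1 - ?k"
     "z \<noteq> 0" "a = nat z" "Suc (ncols YCol R') - b' = nat (- z)"
    and st: "\<And>r r'. z = int (length R) + 1 - ?k \<Longrightarrow> z > 0 \<Longrightarrow>
       int (ncols YCol R') + r' - r = ?k \<Longrightarrow> step (R, r) (R', r')"
    "\<And>r r'. z = - ?k \<Longrightarrow> z < 0 \<Longrightarrow>
       int (ncols YCol R') + r' - r = ?k - 1 \<Longrightarrow> step (R, r) (R', r')"
    by (rule step_Cons) simp
  show ?thesis
  proof (cases "z < 0")
    case True
    then have eq: "z = - (int (ncols YCol R') + 1 - int b')" and a: "a = 0"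
      using z(4,5) assms(2) by (simp_all add: of_nat_diff nat_eq_iff2)
    show ?thesis
    proof (rule zero)
      show "b' < Suc (ncols YCol R')" using True eq by linarith
      show "s \<le> int b' + s'" using z(1) unfolding eq by simp
      fix r r' assume "s = int b' + s'" "r' - r = s' - s"
      then show "step (R, r) (R', r')" using True by (intro st(2)) (simp_all add: eq)
    qed (fact a)
  next
    case False
    then have eq: "z = int a" "0 < a" and b: "b' = Suc (ncols YCol R')"
      using z(3-5) assms(2) by simp_all
    show ?thesis
    proof (rule full)
      show "int a - s \<le> int (ncols XCol R') - s'" using z(2) unfolding eq len by simp
      fix r r' assume "int a - s = int (ncols XCol R') - s'" "r' - r = s' - s + 1"
      then show "step (R, r) (R', r')" using eq(2) by (intro st(1)) (simp_all add: eq(1) len)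
    qed (fact eq b)+
  qed
qed

lemma step_YX:
  assumes "step ((YCol, b) # R, s) ((XCol, a') # R', s')" "a' \<le> Suc (ncols XCol R')"
    "length R' = length R"
  obtains (zero) "b = 0" "- s \<le> int a' - s'"
      "\<And>r r'. - s = int a' - s' \<Longrightarrow> r' - r = s' - s \<Longrightarrow> step (R, r) (R', r')"
  | (full) "0 < b" "a' = Suc (ncols XCol R')" "int b + s \<le> int (ncols YCol R') + s'"
      "\<And>r r'. int b + s = int (ncols YCol R') + s' \<Longrightarrow> r' - r = s' - s - 1 \<Longrightarrow> step (R, r) (R', r')"
proof -
  have len: "int (length R) = int (ncols XCol R') + int (ncols YCol R')"
    using assms(3) length_eq_ncols[of R'] by simp
  let ?k = "int (ncols YCol R') + s' - s"
  from assms(1) obtain z where z: "- ?k \<le> z" "z \<le> int (length R) + 1 - ?k"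
     "z \<noteq> 0" "Suc (ncols XCol R') - a' = nat z" "b = nat (- z)"
    and st: "\<And>r r'. z = int (length R) + 1 - ?k \<Longrightarrow> z > 0 \<Longrightarrow>
       int (ncols YCol R') + r' - r = ?k \<Longrightarrow> step (R, r) (R', r')"
    "\<And>r r'. z = - ?k \<Longrightarrow> z < 0 \<Longrightarrow>
       int (ncols YCol R') + r' - r = ?k - 1 \<Longrightarrow> step (R, r) (R', r')"
    by (rule step_Cons) simp
  show ?thesis
  proof (cases "z < 0")
    case False
    then have eq: "z = int (ncols XCol R') + 1 - int a'" and b: "b = 0"
      using z(4,5) assms(2) by (simp_all add: of_nat_diff nat_eq_iff2)
    show ?thesis
    proof (rule zero)
      show "- s \<le> int a' - s'" using z(2) unfolding eq len by simp
      fix r r' assume "- s = int a' - s'" "r' - r = s' - s"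
      then show "step (R, r) (R', r')" using False z(3) by (intro st(1)) (simp_all add: eq len)
    qed (fact b)
  next
    case True
    then have eq: "z = - int b" "0 < b" and a: "a' = Suc (ncols XCol R')"
      using z(3-5) assms(2) by simp_all
    show ?thesis
    proof (rule full)
      show "int b + s \<le> int (ncols YCol R') + s'" using z(1) unfolding eq by simp
      fix r r' assume "int b + s = int (ncols YCol R') + s'" "r' - r = s' - s - 1"
      then show "step (R, r) (R', r')" using eq(2) by (intro st(2)) (simp_all add: eq(1))
    qed (fact eq a)+
  qed
qed

section \<open>The pairing has no cycles\<close>

text \<open>The drawings and offsets that can occur in a cycle after some columns have been removed. The level
  \<open>t\<close>, the number of \<open>y\<close>-columns plus the offset, is at most \<open>T\<close>. At level \<open>T\<close> with offset \<open>0\<close>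
  all admissible drawings are allowed. Below level \<open>T\<close> the offset is \<open>0\<close> and the first uniform
  \<open>x\<close>-column is not white; with a positive offset the level is \<open>T\<close> and the first uniform \<open>x\<close>-column is
  not crossed. All drawings with \<open>K\<close> columns of type \<open>y\<close> form such a class with \<open>T = K\<close> and offset \<open>0\<close>,
  and removing the first column from a cycle leads to such a class again, which is what the induction needs.\<close>

definition in_class :: "int \<Rightarrow> drawing \<Rightarrow> int \<Rightarrow> bool" where
  "in_class T D s \<longleftrightarrow> admissible D \<and> 0 \<le> s \<and> int (ncols YCol D) + s \<le> T \<and> T \<le> int (length D) \<and>
     (0 < s \<longrightarrow> int (ncols YCol D) + s = T \<and> first_uniform D \<noteq> Crossed) \<and>
     (int (ncols YCol D) + s < T \<longrightarrow> first_uniform D \<noteq> White)"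

lemma in_class_XCons:
  assumes "in_class T ((XCol, a) # R) s"
  shows "a \<le> Suc (ncols XCol R)" "admissible R" "0 \<le> s" "int (ncols YCol R) + s \<le> T"
    "T \<le> int (length R) + 1"
    "0 < s \<Longrightarrow> int (ncols YCol R) + s = T"
    "0 < s \<Longrightarrow> a < Suc (ncols XCol R)"
    "0 < s \<Longrightarrow> 0 < a \<Longrightarrow> first_uniform R \<noteq> Crossed"
    "int (ncols YCol R) + s < T \<Longrightarrow> 0 < a"
    "int (ncols YCol R) + s < T \<Longrightarrow> a < Suc (ncols XCol R) \<Longrightarrow> first_uniform R \<noteq> White"
  using assms by (auto simp: in_class_def split: if_splits)

lemma in_class_YCons:
  assumes "in_class T ((YCol, b) # R) s"
  shows "b \<le> Suc (ncols YCol R)" "admissible R" "0 \<le> s" "int (ncols YCol R) + 1 + s \<le> T"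
    "T \<le> int (length R) + 1"
    "0 < s \<Longrightarrow> int (ncols YCol R) + 1 + s = T"
    "0 < s \<Longrightarrow> first_uniform R \<noteq> Crossed"
    "int (ncols YCol R) + 1 + s < T \<Longrightarrow> first_uniform R \<noteq> White"
    "b = 0 \<Longrightarrow> first_uniform R \<noteq> White"
    "b = Suc (ncols YCol R) \<Longrightarrow> first_uniform R \<noteq> Crossed"
  using assms by (auto simp: in_class_def)

lemma no_uniform_imp_all_YCol:
  assumes "admissible R" "first_uniform R \<noteq> White" "first_uniform R \<noteq> Crossed"
  shows "ncols YCol R = length R"
proof -
  have "first_uniform R = Absent"
    using assms(2,3) by (cases "first_uniform R") auto
  then show ?thesis
    using first_uniform_Absent_iff[OF assms(1)] length_eq_ncols[of R] by simp
qed

text \<open>In the second alternative the \<open>y\<close>-column of the target is fully crossed, so the first uniform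
  \<open>x\<close>-column to its right is not crossed. Below level \<open>T\<close> it is not white either, and there would be no
  \<open>x\<close>-column at all; so the level is \<open>T\<close>.\<close>

lemma transition_XY:
  assumes st: "step ((XCol, a) # R, s) ((YCol, b') # R', s')"
    and E: "in_class T ((YCol, b') # R') s'"
    and len: "length R' = length R"
  obtains (zero) "a = 0" "s \<le> int b' + s'"
      "\<And>r r'. s = int b' + s' \<Longrightarrow> r' - r = s' - s \<Longrightarrow> step (R, r) (R', r')"
  | (full) "0 < a" "int b' + s' = T" "int a - s \<le> int (length R) + 1 - T"
      "\<And>r r'. int a - s = int (length R) + 1 - T \<Longrightarrow> r' - r = s' - s + 1 \<Longrightarrow> step (R, r) (R', r')"
  using st in_class_YCons(1)[OF E] len
proof (cases rule: step_XY)
  case full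
  have "int (ncols YCol R') + 1 + s' = T"
  proof (rule ccontr)
    assume "\<not> ?thesis"
    then have "int (ncols YCol R') + 1 + s' < T" using in_class_YCons(4)[OF E] by simp
    then have "ncols YCol R' = length R'"
      using no_uniform_imp_all_YCol in_class_YCons(2,8,10)[OF E] full(2) by blast
    then show False
      using \<open>int (ncols YCol R') + 1 + s' < T\<close> in_class_YCons(3,5)[OF E] by simp
  qed
  moreover from this have "int (ncols XCol R') - s' = int (length R) + 1 - T"
    using length_eq_ncols[of R'] len by simp
  ultimately show ?thesis
    using full that(2) by simp
qed (use that(1) in blast)

text \<open>In the first alternative the \<open>y\<close>-column of the source has no crosses, so the first uniform \<open>x\<close>-column to its
  right is not white, which excludes a positive offset. In the second one the \<open>x\<close>-column of the target is
  fully crossed, which again excludes a positive offset, now of the target.\<close>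

lemma transition_YX:
  assumes st: "step ((YCol, b) # R, s) ((XCol, a') # R', s')"
    and D: "in_class T ((YCol, b) # R) s" and E: "in_class T ((XCol, a') # R') s'"
    and len: "length R' = length R"
  obtains (zero) "b = 0" "s = 0" "0 \<le> int a' - s'"
      "\<And>r r'. 0 = int a' - s' \<Longrightarrow> r' - r = s' - s \<Longrightarrow> step (R, r) (R', r')"
  | (full) "0 < b" "a' = Suc (ncols XCol R')" "s' = 0" "int b + s \<le> int (ncols YCol R')"
      "\<And>r r'. int b + s = int (ncols YCol R') \<Longrightarrow> r' - r = s' - s - 1 \<Longrightarrow> step (R, r) (R', r')"
  using st in_class_XCons(1)[OF E] len
proof (cases rule: step_YX)
  case zero
  have s: "s = 0"
  proof (rule ccontr)
    assume "s \<noteq> 0"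
    then have "0 < s" using in_class_YCons(3)[OF D] by simp
    then have "ncols YCol R = length R"
      using no_uniform_imp_all_YCol in_class_YCons(2,7,9)[OF D] zero(1) by blast
    then show False
      using \<open>0 < s\<close> in_class_YCons(4,5)[OF D] by simp
  qed
  show ?thesis
    using that(1) zero s by simp
next
  case full
  have "s' = 0"
    using in_class_XCons(3,7)[OF E] full(2) by force
  then show ?thesis
    using that(2) full by simp
qed

text \<open>In a cycle whose first columns are all \<open>x\<close>-columns, \<open>\<alpha> = a - s\<close> is constant. This lemma and the next
  identify the class of the remainders, for negative and for nonnegative \<open>\<alpha>\<close>. In the negative case all
  offsets are positive and may be lowered by \<open>- \<alpha>\<close>; offset \<open>0\<close> is reached exactly by the white first
  columns, behind which anything may follow. In the nonnegative case, where the offsets stay, the drawings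
  with \<open>m - \<alpha>\<close> columns of type \<open>y\<close> among the \<open>m\<close> columns have a fully crossed first column, behind
  which anything may follow.\<close>

lemma in_class_tail_X_negative:
  assumes D: "in_class T ((XCol, a) # R) s" and neg: "int a - s < 0"
  shows "in_class (T + (int a - s)) R (s + (int a - s))"
proof -
  note facts = in_class_XCons[OF D]
  have "0 < s" using neg by simp
  show ?thesis
    using facts(2) facts(6-8)[OF \<open>0 < s\<close>] length_eq_ncols[of R]
    unfolding in_class_def by auto
qed

lemma in_class_tail_X_nonneg:
  assumes D: "in_class T ((XCol, a) # R) s" and nonneg: "0 \<le> int a - s"
  shows "in_class (min T (int (length R) + 1 - (int a - s))) R s"
proof -
  note facts = in_class_XCons[OF D]
  have len: "int (length R) = int (ncols XCol R) + int (ncols YCol R)"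
    using length_eq_ncols[of R] by simp
  show ?thesis
  proof (cases "0 < s")
    case True
    then have "0 < a" using nonneg by simp
    have "T < int (length R) + 1 - (int a - s)"
      using facts(6,7)[OF True] len by linarith
    then show ?thesis
      using facts(2,3) facts(6-8)[OF True] \<open>0 < a\<close> nonneg
      unfolding in_class_def by (auto simp: min_def)
  next
    case False
    then have s: "s = 0" using facts(3) by simp
    have a: "0 < a" if "int (ncols YCol R) < T" using facts(9) that s by simp
    have white: "first_uniform R \<noteq> White" 
      if "int (ncols YCol R) < T" "a < Suc (ncols XCol R)"
      using facts(10) that s by simp
    have "in_class (min T (int (length R) + 1 - int a)) R 0"
      unfolding in_class_def
    proof (intro conjI impI)
      show "min T (int (length R) + 1 - int a) \<le> int (length R)"
      proof (cases "int (ncols YCol R) < T")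
        case True
        then show ?thesis using a by (simp add: min_def)
      qed (use len in simp)
      show "first_uniform R \<noteq> White" if "int (ncols YCol R) + 0 < min T (int (length R) + 1 - int a)"
        using that white len by auto
    qed (use facts(1,2,4) s len in auto)
    then show ?thesis using s by simp
  qed
qed

lemma in_class_tail_Y:
  assumes D: "in_class T ((YCol, b) # R) s"
  shows "in_class (T - 1) R s"
  using in_class_YCons[OF D] unfolding in_class_def by auto

lemma periodic_monotone_constant:
  fixes f :: "nat \<Rightarrow> int"
  assumes "0 < p" "\<And>i. f (i + p) = f i" "\<And>i. f i \<le> f (Suc i)"
  shows "f i = f 0"
proof -
  have mono: "i \<le> j \<Longrightarrow> f i \<le> f j" for i j
    using assms(3) by (rule lift_Suc_mono_le)
  have per: "f (k * p) = f 0" for k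
  proof (induction k)
    case (Suc k)
    then show ?case using assms(2)[of "k * p"] by (simp add: add.commute)
  qed simp
  have "f i \<le> f (i * p)" using assms(1) by (intro mono) simp
  moreover have "f 0 \<le> f i" by (intro mono) simp
  ultimately show ?thesis using per[of i] by simp
qed

text \<open>A closed walk that visits both \<open>Q\<close> and its complement leaves \<open>Q\<close> at some step.\<close>

lemma periodic_leaves:
  assumes per: "\<And>i. f (i + p) = f i" and p: "0 < p"
    and "Q (f i)" "\<not> Q (f j)"
  shows "\<exists>k. Q (f k) \<and> \<not> Q (f (Suc k))"
proof (rule ccontr)
  assume no: "\<not> ?thesis"
  have stay: "Q (f (i + d))" for d
    by (induction d) (use no \<open>Q (f i)\<close> in auto)
  have "f (j + k * p) = f j" for k
  proof (induction k)
    case (Suc k)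
    then show ?case using per[of "j + k * p"] by (simp add: algebra_simps)
  qed simp
  moreover have "j + i * p = i + (j + i * p - i)"
    using p by (cases p) auto
  ultimately show False
    using stay[of "j + i * p - i"] \<open>\<not> Q (f j)\<close> by metis
qed

text \<open>Induction on the number \<open>m\<close> of columns. If the first columns along the closed walk are all of one type,
  \<open>\<alpha>\<close> or \<open>\<beta>\<close> never decreases, hence is constant, all exponents at the first place are extremal, and
  the remainders form a closed walk in a class with fewer columns.

  If both types occur, the values \<open>\<alpha>\<close> and \<open>\<beta>\<close> are compared on a common scale by the potential
  \<open>\<alpha> T\<close>, respectively \<open>\<beta> (m - T)\<close>. Along a step it never decreases, so on a closed walk it is constant, and the changes of type force
  it to be \<open>0\<close> or \<open>T (m - T)\<close>. In the first case the first columns just before a change of type are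
  white, in the second case those just after a change are fully crossed. Either way the remainders, with suitable
  offsets, form a closed walk of a class with the same \<open>T\<close>, which is constant by induction; but before and
  after a change from an \<open>x\<close>- to a \<open>y\<close>-column either the remainders or their offsets differ. So mixed closed
  walks do not exist.\<close>

theorem closed_walk_constant:
  assumes p: "0 < p"
    and periodic: "\<And>i. P (i + p) = P i"
    and steps: "\<And>i. step (P i) (P (Suc i))"
    and in_class: "\<And>i. in_class T (fst (P i)) (snd (P i))"
    and len: "\<And>i. length (fst (P i)) = m"
  shows "P i = P 0"
  using periodic steps in_class len
proof (induction m arbitrary: P T i)
  case 0
  have [simp]: "fst (P j) = []" for j
    using "0.prems"(4)[of j] by simp
  have "snd (P (Suc j)) = snd (P j)" for j
    using "0.prems"(2)[of j] by (auto simp: step_def fits_def)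
  then have "snd (P j) = snd (P 0)" for j
    by (induction j) auto
  then show ?case
    by (simp add: prod_eq_iff)
next
  case (Suc m)
  define t where "t i = fst (hd (fst (P i)))" for i
  define a where "a i = snd (hd (fst (P i)))" for i
  define R where "R i = tl (fst (P i))" for i
  define s where "s i = snd (P i)" for i
  have P: "P i = ((t i, a i) # R i, s i)" for i
    using Suc.prems(4)[of i] unfolding t_def a_def R_def s_def
    by (cases "P i"; cases "fst (P i)") auto
  have lenR: "length (R i) = m" for i
    using Suc.prems(4)[of i] unfolding P by simp
  have per: "t (i + p) = t i" "a (i + p) = a i" "R (i + p) = R i" "s (i + p) = s i" for i
    using Suc.prems(1)[of i] unfolding P by auto
  have step: "step ((t i, a i) # R i, s i) ((t (Suc i), a (Suc i)) # R (Suc i), s (Suc i))" for i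
    using Suc.prems(2)[of i] unfolding P .
  have cls: "in_class T ((t i, a i) # R i) (s i)" for i
    using Suc.prems(3)[of i] unfolding P by simp
  have X: "in_class T ((XCol, a i) # R i) (s i)" if "t i = XCol" for i
    using cls[of i] that by simp
  have Y: "in_class T ((YCol, a i) # R i) (s i)" if "t i = YCol" for i
    using cls[of i] that by simp
  have lenR': "length (R (Suc i)) = length (R i)" for i by (simp add: lenR)
  have XX: "int (a i) - s i \<le> int (a (Suc i)) - s (Suc i)"
      "int (a i) - s i = int (a (Suc i)) - s (Suc i) \<Longrightarrow> r' - r = s (Suc i) - s i \<Longrightarrow>
        step (R i, r) (R (Suc i), r')"
    if "t i = XCol" "t (Suc i) = XCol" for i r r'
    using step_XX[OF _ in_class_XCons(1)[OF X[of "Suc i"]] lenR', of "a i" "s i" "s (Suc i)"]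
      step[of i] that by auto
  have YY: "int (a i) + s i \<le> int (a (Suc i)) + s (Suc i)"
      "int (a i) + s i = int (a (Suc i)) + s (Suc i) \<Longrightarrow> r' - r = s (Suc i) - s i \<Longrightarrow>
        step (R i, r) (R (Suc i), r')"
    if "t i = YCol" "t (Suc i) = YCol" for i r r'
    using step_YY[OF _ in_class_YCons(1)[OF Y[of "Suc i"]] lenR', of "a i" "s i" "s (Suc i)"]
      step[of i] that by auto
  have IH: "(R i, r i) = (R 0, r 0)"
    if "\<And>i. r (i + p) = r i" "\<And>i. step (R i, r i) (R (Suc i), r (Suc i))"
       "\<And>i. in_class T' (R i) (r i)" for T' r i
    by (rule Suc.IH[of "\<lambda>i. (R i, r i)" T']) (use that per(3) lenR in auto)
  consider (allX) "\<And>i. t i = XCol" | (allY) "\<And>i. t i = YCol"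
    | (mixed) j k where "t j = XCol" "t k = YCol"
    by (metis coltype.exhaust)
  then show ?case
  proof cases
    case allX
    define \<alpha> where "\<alpha> = int (a 0) - s 0"
    have \<alpha>: "int (a i) - s i = \<alpha>" for i
      unfolding \<alpha>_def
      by (rule periodic_monotone_constant[of p "\<lambda>i. int (a i) - s i"]) (use p per XX(1) allX in auto)
    have tail: "step (R i, s i + c) (R (Suc i), s (Suc i) + c)" for i c
      by (rule XX(2)) (use allX \<alpha> in auto)
    have "R i = R 0 \<and> s i = s 0"
    proof (cases "\<alpha> < 0")
      case True
      have "in_class (T + \<alpha>) (R i) (s i + \<alpha>)" for i
        using in_class_tail_X_negative[OF X[OF allX[of i]]] True \<alpha>[of i] by simp
      from IH[of "\<lambda>i. s i + \<alpha>", OF _ tail this] per(4) show ?thesis by simp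
    next
      case False
      have "in_class (min T (int m + 1 - \<alpha>)) (R i) (s i + 0)" for i
        using in_class_tail_X_nonneg[OF X[OF allX[of i]]] False \<alpha>[of i] lenR[of i] by simp
      from IH[of "\<lambda>i. s i + 0", OF _ tail this] per(4) show ?thesis by simp
    qed
    then show ?thesis
      using \<alpha>[of i] \<alpha>[of 0] allX unfolding P by simp
  next
    case allY
    have \<beta>: "int (a i) + s i = int (a 0) + s 0" for i
      by (rule periodic_monotone_constant[of p "\<lambda>i. int (a i) + s i"]) (use p per YY(1) allY in auto)
    have tail: "step (R i, s i) (R (Suc i), s (Suc i))" for i
      by (rule YY(2)) (use allY \<beta>[of i] \<beta>[of "Suc i"] in auto)
    have "in_class (T - 1) (R i) (s i)" for i
      using in_class_tail_Y[OF Y[OF allY[of i]]] .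
    from IH[of s, OF _ tail this] per(4) have "R i = R 0 \<and> s i = s 0" by simp
    then show ?thesis
      using \<beta>[of i] allY unfolding P by simp
  next
    case (mixed j k)
    define M where "M = int m + 1"
    define \<phi> where "\<phi> i = (if t i = XCol then (int (a i) - s i) * T else (int (a i) + s i) * (M - T))" for i
    have s0: "0 \<le> s i" for i using cls[of i] by (simp add: in_class_def)
    have TM: "T \<le> M" using cls[of 0] lenR[of 0] by (simp add: in_class_def M_def)
    have "0 < T" using in_class_YCons(3,4)[OF Y[OF mixed(2)]] by simp
    have neqX: "t i \<noteq> XCol \<longleftrightarrow> t i = YCol" for i by (cases "t i") auto
    have XY: "(a i = 0 \<and> s i \<le> int (a (Suc i)) + s (Suc i) \<and>
          (\<forall>r r'. s i = int (a (Suc i)) + s (Suc i) \<longrightarrow> r' - r = s (Suc i) - s i \<longrightarrow>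
            step (R i, r) (R (Suc i), r'))) \<or>
        (0 < a i \<and> int (a (Suc i)) + s (Suc i) = T \<and> int (a i) - s i \<le> M - T \<and>
          (\<forall>r r'. int (a i) - s i = M - T \<longrightarrow> r' - r = s (Suc i) - s i + 1 \<longrightarrow>
            step (R i, r) (R (Suc i), r')))"
      if "t i = XCol" "t (Suc i) = YCol" for i
      using step[of i] unfolding that
      by (rule transition_XY[OF _ Y[OF that(2)] lenR'])
        (auto simp: lenR M_def)
    have YX: "(a i = 0 \<and> s i = 0 \<and> 0 \<le> int (a (Suc i)) - s (Suc i) \<and>
          (\<forall>r r'. 0 = int (a (Suc i)) - s (Suc i) \<longrightarrow> r' - r = s (Suc i) - s i \<longrightarrow>
            step (R i, r) (R (Suc i), r'))) \<or>
        (0 < a i \<and> a (Suc i) = Suc (ncols XCol (R (Suc i))) \<and> s (Suc i) = 0 \<and>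
          int (a i) + s i \<le> int (ncols YCol (R (Suc i))) \<and>
          (\<forall>r r'. int (a i) + s i = int (ncols YCol (R (Suc i))) \<longrightarrow> r' - r = s (Suc i) - s i - 1 \<longrightarrow>
            step (R i, r) (R (Suc i), r')))"
      if "t i = YCol" "t (Suc i) = XCol" for i
      using step[of i] unfolding that
      by (rule transition_YX[OF _ Y[OF that(1)] X[OF that(2)] lenR']) auto
    have xy: "int (ncols XCol (R i)) + int (ncols YCol (R i)) = int m" for i
      using length_eq_ncols[of "R i"] lenR[of i] by simp
    have "\<phi> i \<le> \<phi> (Suc i)" for i
    proof (cases "t i"; cases "t (Suc i)")
      assume t: "t i = XCol" "t (Suc i) = XCol"
      show ?thesis using XX(1)[OF t] t \<open>0 < T\<close> by (simp add: \<phi>_def)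
    next
      assume t: "t i = YCol" "t (Suc i) = YCol"
      show ?thesis using YY(1)[OF t] t TM by (simp add: \<phi>_def mult_right_mono)
    next
      assume t: "t i = XCol" "t (Suc i) = YCol"
      from XY[OF t] show ?thesis
      proof (elim disjE conjE)
        assume "a i = 0" "s i \<le> int (a (Suc i)) + s (Suc i)"
        then have "(int (a i) - s i) * T \<le> 0" "0 \<le> (int (a (Suc i)) + s (Suc i)) * (M - T)"
          using s0[of i] \<open>0 < T\<close> TM by (simp_all add: mult_le_0_iff)
        then show ?thesis using t by (simp add: \<phi>_def)
      next
        assume "int (a (Suc i)) + s (Suc i) = T" "int (a i) - s i \<le> M - T"
        then show ?thesis using t mult_right_mono[of "int (a i) - s i" "M - T" T] \<open>0 < T\<close>
          by (simp add: \<phi>_def mult.commute)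
      qed
    next
      assume t: "t i = YCol" "t (Suc i) = XCol"
      from YX[OF t] show ?thesis
      proof (elim disjE conjE)
        assume "a i = 0" "s i = 0" "0 \<le> int (a (Suc i)) - s (Suc i)"
        then show ?thesis using t \<open>0 < T\<close> by (simp add: \<phi>_def)
      next
        define y where "y = int (ncols YCol (R (Suc i)))"
        assume full: "a (Suc i) = Suc (ncols XCol (R (Suc i)))" "s (Suc i) = 0"
          "int (a i) + s i \<le> int (ncols YCol (R (Suc i)))"
        have "y \<le> T" using in_class_XCons(4)[OF X[OF t(2)]] full(2) by (simp add: y_def)
        have "(int (a i) + s i) * (M - T) \<le> y * (M - T)"
          using full(3) TM by (intro mult_right_mono) (simp_all add: y_def)
        also have "\<dots> \<le> (M - y) * T"
          using mult_left_mono[OF \<open>y \<le> T\<close>, of M] by (simp add: M_def algebra_simps)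
        also have "M - y = int (a (Suc i)) - s (Suc i)"
          using full(1,2) xy[of "Suc i"] by (simp add: M_def y_def)
        finally show ?thesis using t by (simp add: \<phi>_def)
      qed
    qed
    then have \<phi>: "\<phi> i = \<phi> 0" for i
      by (intro periodic_monotone_constant[of p \<phi>]) (use p per in \<open>auto simp: \<phi>_def\<close>)
    obtain i where i: "t i = XCol" "t (Suc i) = YCol"
      using periodic_leaves[of t p "\<lambda>c. c = XCol" j k] per(1) p mixed neqX by auto
    have level: "(\<phi> 0 = 0 \<and> s i = 0 \<and> a i = 0) \<or> (\<phi> 0 = (M - T) * T \<and> 0 < a i \<and> int (a i) - s i = M - T)"
      using XY[OF i]
    proof (elim disjE conjE)
      assume zero: "a i = 0" "s i \<le> int (a (Suc i)) + s (Suc i)"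
      then have "(int (a i) - s i) * T \<le> 0" "0 \<le> (int (a (Suc i)) + s (Suc i)) * (M - T)"
        using s0[of i] \<open>0 < T\<close> TM by (simp_all add: mult_le_0_iff)
      then have "\<phi> 0 = 0"
        using i \<phi>[of i] \<phi>[of "Suc i"] by (simp add: \<phi>_def)
      moreover from this have "s i = 0"
        using i \<phi>[of i] zero(1) \<open>0 < T\<close> by (simp add: \<phi>_def)
      ultimately show ?thesis using zero(1) by simp
    next
      assume full: "0 < a i" "int (a (Suc i)) + s (Suc i) = T"
      then have "\<phi> 0 = (M - T) * T"
        using i \<phi>[of "Suc i"] by (simp add: \<phi>_def mult.commute)
      moreover from this have "int (a i) - s i = M - T"
        using i \<phi>[of i] \<open>0 < T\<close> by (simp add: \<phi>_def)
      ultimately show ?thesis using full(1) by simp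
    qed
    have "T < M"
    proof (rule ccontr)
      assume "\<not> T < M"
      then have "T = M" using TM by simp
      note facts = in_class_XCons[OF X[OF i(1)]]
      show False
      proof (cases "s i = 0")
        case True
        then have "a i = 0" using level \<open>T = M\<close> by auto
        then show False using facts(9) True xy[of i] \<open>T = M\<close> by (simp add: M_def)
      next
        case False
        then have "int (a i) = s i" "0 < s i" using level \<open>T = M\<close> s0[of i] by auto
        then show False using facts(6,7) xy[of i] \<open>T = M\<close> by (simp add: M_def)
      qed
    qed
    from level show ?thesis
    proof (elim disjE conjE)
      \<comment> \<open>Potential \<open>0\<close>: all \<open>\<alpha>\<close> and \<open>\<beta>\<close> vanish, and the offsets are kept.\<close>
      assume "\<phi> 0 = 0" "s i = 0" "a i = 0"
      have \<alpha>: "int (a l) = s l" if "t l = XCol" for l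
        using that \<phi>[of l] \<open>\<phi> 0 = 0\<close> \<open>0 < T\<close> by (simp add: \<phi>_def)
      have \<beta>: "a l = 0" "s l = 0" if "t l = YCol" for l
        using that \<phi>[of l] \<open>\<phi> 0 = 0\<close> \<open>T < M\<close> s0[of l] by (auto simp: \<phi>_def)
      have "in_class T (R l) (s l)" for l
      proof (cases "t l")
        case XCol
        then show ?thesis
          using in_class_tail_X_nonneg[OF X[OF XCol]] \<alpha>[OF XCol] TM lenR[of l] by (simp add: M_def)
      next
        case YCol
        then show ?thesis
          using in_class_YCons[OF Y[OF YCol]] \<beta>[OF YCol] \<open>T < M\<close> lenR[of l]
          by (auto simp: in_class_def M_def)
      qed
      moreover have "step (R l, s l) (R (Suc l), s (Suc l))" for l
      proof (cases "t l"; cases "t (Suc l)")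
        assume t: "t l = XCol" "t (Suc l) = XCol"
        show ?thesis by (rule XX(2)[OF t]) (use \<alpha> t in auto)
      next
        assume t: "t l = YCol" "t (Suc l) = YCol"
        show ?thesis by (rule YY(2)[OF t]) (use \<beta> t in auto)
      next
        assume t: "t l = XCol" "t (Suc l) = YCol"
        from XY[OF t] \<alpha>[OF t(1)] \<beta>[OF t(2)] \<open>0 < T\<close> show ?thesis by auto
      next
        assume t: "t l = YCol" "t (Suc l) = XCol"
        from YX[OF t] \<beta>[OF t(1)] \<alpha>[OF t(2)] show ?thesis by auto
      qed
      ultimately have "R l = R 0" for l
        using IH[of s T] per(4) by blast
      then have "R (Suc i) = R i" by metis
      moreover have "int (ncols YCol (R i)) = T"
        using in_class_XCons(4,9)[OF X[OF i(1)]] \<open>s i = 0\<close> \<open>a i = 0\<close> by fastforce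
      ultimately show ?thesis
        using in_class_YCons(3,4)[OF Y[OF i(2)]] by simp
    next
      \<comment> \<open>Potential \<open>(M - T) * T\<close>: all \<open>\<alpha>\<close> are \<open>M - T\<close> and all \<open>\<beta>\<close> are \<open>T\<close>. Removing a fully crossed \<open>y\<close>-column lowers the number of \<open>y\<close>-columns, and the offset is raised to stay at level \<open>T\<close>.\<close>
      assume "\<phi> 0 = (M - T) * T"
      have \<alpha>: "int (a l) - s l = M - T" if "t l = XCol" for l
        using that \<phi>[of l] \<open>\<phi> 0 = (M - T) * T\<close> \<open>0 < T\<close> by (simp add: \<phi>_def)
      have \<beta>: "int (a l) + s l = T" if "t l = YCol" for l
        using that \<phi>[of l] \<open>\<phi> 0 = (M - T) * T\<close> \<open>T < M\<close> by (simp add: \<phi>_def mult.commute)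
      have sX: "s l = 0" if "t l = XCol" for l
      proof (rule ccontr)
        assume "s l \<noteq> 0"
        then have "0 < s l" using s0[of l] by simp
        then show False
          using in_class_XCons(6,7)[OF X[OF that]] xy[of l] \<alpha>[OF that] by (simp add: M_def)
      qed
      define r where "r l = (if t l = XCol then 0 else s l + 1)" for l
      have "in_class T (R l) (r l)" for l
      proof (cases "t l")
        case XCol
        then show ?thesis
          using in_class_tail_X_nonneg[OF X[OF XCol]] \<alpha>[OF XCol] sX[OF XCol] TM lenR[of l]
          by (simp add: M_def r_def)
      next
        case YCol
        note facts = in_class_YCons[OF Y[OF YCol]]
        have "a l = Suc (ncols YCol (R l))" "int (ncols YCol (R l)) + 1 + s l = T"
          using facts(1,4) \<beta>[OF YCol] by linarith+
        then show ?thesis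
          using facts(2,3,10) YCol \<open>T < M\<close> lenR[of l]
          by (auto simp: in_class_def M_def r_def)
      qed
      moreover have "step (R l, r l) (R (Suc l), r (Suc l))" for l
      proof (cases "t l"; cases "t (Suc l)")
        assume t: "t l = XCol" "t (Suc l) = XCol"
        show ?thesis by (rule XX(2)[OF t]) (use \<alpha> sX t in \<open>auto simp: r_def\<close>)
      next
        assume t: "t l = YCol" "t (Suc l) = YCol"
        show ?thesis by (rule YY(2)[OF t]) (use \<beta> t in \<open>auto simp: r_def\<close>)
      next
        assume t: "t l = XCol" "t (Suc l) = YCol"
        from XY[OF t] show ?thesis
        proof (elim disjE conjE)
          assume "a l = 0"
          then show ?thesis using \<alpha>[OF t(1)] sX[OF t(1)] \<open>T < M\<close> by simp
        next
          assume *: "\<forall>r r'. int (a l) - s l = M - T \<longrightarrow> r' - r = s (Suc l) - s l + 1 \<longrightarrow>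
            step (R l, r) (R (Suc l), r')"
          show ?thesis by (rule *[rule_format, OF \<alpha>[OF t(1)]]) (use sX[OF t(1)] t in \<open>simp add: r_def\<close>)
        qed
      next
        assume t: "t l = YCol" "t (Suc l) = XCol"
        from YX[OF t] show ?thesis
        proof (elim disjE conjE)
          assume "a l = 0" "s l = 0"
          then show ?thesis using \<beta>[OF t(1)] \<open>0 < T\<close> by simp
        next
          assume "a (Suc l) = Suc (ncols XCol (R (Suc l)))"
            and *: "\<forall>r r'. int (a l) + s l = int (ncols YCol (R (Suc l))) \<longrightarrow>
              r' - r = s (Suc l) - s l - 1 \<longrightarrow> step (R l, r) (R (Suc l), r')"
          then have "int (a l) + s l = int (ncols YCol (R (Suc l)))"
            using \<alpha>[OF t(2)] \<beta>[OF t(1)] sX[OF t(2)] xy[of "Suc l"] by (simp add: M_def)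
          then show ?thesis
            by (rule *[rule_format]) (use sX[OF t(2)] t in \<open>simp add: r_def\<close>)
        qed
      qed
      moreover have "r (l + p) = r l" for l
        by (simp add: r_def per)
      ultimately have "r l = r 0" for l
        using IH[of r T] by blast
      then have "r i = r (Suc i)" by metis
      then show ?thesis
        using i s0[of "Suc i"] by (simp add: r_def)
    qed
  qed
qed

section \<open>Coefficients of the derivatives of drawings\<close>

definition cross_list :: "drawing \<Rightarrow> var list" where
  "cross_list D = concat (map (\<lambda>i. replicate (crosses D i) (place_var D i)) [0..<length D])"

lemma partial_drawing_eq: "partial_drawing D p = pderivs (cross_list D) p"
  by (simp add: partial_drawing_def cross_list_def)

lemma lookup_cross_list:
  "Poly_Mapping.lookup (exponents (cross_list D)) (X k) =
     (if 1 \<le> k \<and> k \<le> length D then crosses_of XCol (D ! (k - 1)) else 0)" (is ?X)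
  "Poly_Mapping.lookup (exponents (cross_list D)) (Y k) =
     (if 1 \<le> k \<and> k \<le> length D then crosses_of YCol (D ! (k - 1)) else 0)" (is ?Y)
proof -
  have gen: "Poly_Mapping.lookup (exponents (concat (map (\<lambda>i. replicate (f i) (g i)) [0..<m]))) v =
      (\<Sum>i<m. if g i = v then f i else 0)" for f :: "nat \<Rightarrow> nat" and g m v
    by (induction m) (auto simp: lookup_add lookup_single when_def)
  have sum: "(\<Sum>i<m. if Suc i = k then f i else 0) = (if 1 \<le> k \<and> k \<le> m then f (k - 1) else (0::nat))" for f m
  proof (induction m)
    case (Suc m)
    then show ?case by (cases "k = Suc m") auto
  qed simp
  have x: "(if place_var D i = X k then crosses D i else 0) = (if Suc i = k then crosses_of XCol (D ! i) else 0)"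
   and y: "(if place_var D i = Y k then crosses D i else 0) = (if Suc i = k then crosses_of YCol (D ! i) else 0)" for i
    by (cases "D ! i"; cases "kind D i"; simp add: place_var_def)+
  show ?X ?Y
    unfolding cross_list_def gen x y sum by (rule refl)+
qed

lemma lookup_cross_list_axis:
  assumes "e = 1 \<or> e = -1"
  shows "i < length D \<Longrightarrow> Poly_Mapping.lookup (exponents (cross_list D)) (axis e i) =
      crosses_of (if e = 1 then XCol else YCol) (D ! i)"
    and "length D \<le> i \<Longrightarrow> Poly_Mapping.lookup (exponents (cross_list D)) (axis e i) = 0"
  using assms by (auto simp: axis_def lookup_cross_list)

lemma lookup_cross_list_outside:
  assumes "x \<notin> vars n" "length D \<le> n"
  shows "Poly_Mapping.lookup (exponents (cross_list D)) x = 0"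
  using assms by (cases x) (auto simp: lookup_cross_list vars_def)

lemma sum_eq_vec_monomial_iff:
  assumes "length D = m" "length E = m"
  shows "exponents (cross_list D) + exponents (cross_list E) = vec_monomial (Suc m) v \<longleftrightarrow>
    fits (map v [0..<m]) D E \<and> v m = 0"
proof -
  have "exponents (cross_list D) + exponents (cross_list E) = vec_monomial (Suc m) v \<longleftrightarrow>
    (\<forall>i<m. crosses_of XCol (D ! i) + crosses_of XCol (E ! i) = nat (v i) \<and>
           crosses_of YCol (D ! i) + crosses_of YCol (E ! i) = nat (- v i)) \<and>
    0 = nat (v m) \<and> 0 = nat (- v m)"
    unfolding eq_vec_monomial_iff[of 1, simplified] lookup_add All_less_Suc
    using assms by (auto simp: lookup_cross_list_axis lookup_cross_list_outside)
  also have "\<dots> \<longleftrightarrow> fits (map v [0..<m]) D E \<and> v m = 0"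
    using assms by (auto simp: fits_def)
  finally show ?thesis .
qed

lemma bij_betw_hook_val: "bij_betw (hook_val K) {0..<K + L + 1} {- int K .. int L}"
  unfolding bij_betw_def using hook_val_image inj_on_subset[OF inj_hook_val subset_UNIV] by blast

text \<open>Drawings leave out the last place, which therefore receives the exponent \<open>0\<close>; the zero appended to
  \<open>zs\<close> completes it to an enumeration of all cells.\<close>

lemma permutation_of_values:
  assumes "length zs = K + L" "distinct zs" "set zs = {- int K .. int L} - {0}"
  obtains \<pi> where "\<pi> permutes {0..<K + L + 1}" "map (hook_val K \<circ> \<pi>) [0..<K + L] = zs"
    "hook_val K (\<pi> (K + L)) = 0"
proof -
  let ?n = "K + L + 1"
  define h where "h i = (zs @ [0]) ! i" for i
  have "set (zs @ [0]) = ({- int K .. int L} - {0}) \<union> {0}"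
    by (simp add: assms(3))
  also have "\<dots> = {- int K .. int L}" by auto
  finally have "set (zs @ [0]) = {- int K .. int L}" .
  moreover have "distinct (zs @ [0])" "length (zs @ [0]) = ?n"
    using assms(1,2) by (simp_all add: assms(3))
  ultimately have h: "bij_betw h {0..<?n} {- int K .. int L}"
    using bij_betw_nth[of "zs @ [0]" "{0..<?n}" "{- int K .. int L}"] unfolding h_def
    by (simp add: atLeast0LessThan)
  define \<pi> where "\<pi> i = (if i < ?n then inv_into {0..<?n} (hook_val K) (h i) else i)" for i
  have val: "hook_val K (\<pi> i) = h i" if "i < ?n" for i
    unfolding \<pi>_def using that h bij_betw_hook_val[of K L]
    by (auto simp: bij_betw_def intro!: f_inv_into_f)
  have "bij_betw (inv_into {0..<?n} (hook_val K) \<circ> h) {0..<?n} {0..<?n}"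
    by (rule bij_betw_trans[OF h]) (rule bij_betw_inv_into[OF bij_betw_hook_val])
  then have "bij_betw \<pi> {0..<?n} {0..<?n}"
    by (rule bij_betw_cong[THEN iffD1, rotated]) (auto simp: \<pi>_def)
  then have "\<pi> permutes {0..<?n}"
    by (rule bij_imp_permutes) (auto simp: \<pi>_def)
  moreover have "map (hook_val K \<circ> \<pi>) [0..<K + L] = zs"
    using assms(1) by (intro nth_equalityI) (auto simp: val h_def nth_append)
  moreover have "hook_val K (\<pi> (K + L)) = 0"
    using assms(1) by (simp add: val h_def nth_append)
  ultimately show thesis by (rule that)
qed

text \<open>Distinct permutations give distinct terms with coefficients \<open>1\<close> and \<open>-1\<close>, so nothing cancels.\<close>

lemma Delta_term_iff:
  assumes len: "length D = K + L" "length E = K + L"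
  shows "Poly_Mapping.lookup (Delta (hook K L)) (exponents (cross_list D) + exponents (cross_list E)) \<noteq> 0 \<longleftrightarrow>
    (\<exists>zs. fits zs D E \<and> distinct zs \<and> set zs = {- int K .. int L} - {0})"
proof
  let ?n = "K + L + 1"
  assume "Poly_Mapping.lookup (Delta (hook K L)) (exponents (cross_list D) + exponents (cross_list E)) \<noteq> 0"
  then obtain \<pi> where \<pi>: "\<pi> permutes {0..<?n}"
    and eq: "exponents (cross_list D) + exponents (cross_list E) = vec_monomial ?n (hook_val K \<circ> \<pi>)"
    by (rule lookup_Delta_nonzero)
  define h where "h = hook_val K \<circ> \<pi>"
  have fits: "fits (map h [0..<K + L]) D E" and last: "h (K + L) = 0"
    using eq sum_eq_vec_monomial_iff[OF len, of h] by (simp_all add: h_def)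
  have inj: "inj h"
    unfolding h_def using inj_hook_val permutes_inj[OF \<pi>] by (rule inj_compose)
  have "h ` {0..<?n} = {- int K .. int L}"
    unfolding h_def image_comp[symmetric] permutes_image[OF \<pi>] by (rule hook_val_image)
  moreover have "{0..<K + L} = {0..<?n} - {K + L}" by auto
  ultimately have "h ` {0..<K + L} = {- int K .. int L} - {0}"
    using image_set_diff[OF inj, of "{0..<?n}" "{K + L}"] last by simp
  moreover have "distinct (map h [0..<K + L])"
    using inj by (simp add: distinct_map inj_on_subset[OF inj])
  ultimately show "\<exists>zs. fits zs D E \<and> distinct zs \<and> set zs = {- int K .. int L} - {0}"
    using fits by (intro exI[of _ "map h [0..<K + L]"]) simp
next
  assume "\<exists>zs. fits zs D E \<and> distinct zs \<and> set zs = {- int K .. int L} - {0}"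
  then obtain zs where zs: "fits zs D E" "distinct zs" "set zs = {- int K .. int L} - {0}" by blast
  have "length zs = K + L" using zs(1) len by (simp add: fits_def)
  then obtain \<pi> where \<pi>: "\<pi> permutes {0..<K + L + 1}" "map (hook_val K \<circ> \<pi>) [0..<K + L] = zs"
      "hook_val K (\<pi> (K + L)) = 0"
    using zs(2,3) by (rule permutation_of_values)
  have "exponents (cross_list D) + exponents (cross_list E) = vec_monomial (Suc (K + L)) (hook_val K \<circ> \<pi>)"
    unfolding sum_eq_vec_monomial_iff[OF len] \<pi>(2) using zs(1) \<pi>(3) by simp
  then show "Poly_Mapping.lookup (Delta (hook K L)) (exponents (cross_list D) + exponents (cross_list E)) \<noteq> 0"
    using lookup_Delta_term[OF \<pi>(1)] by (simp add: sign_def)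
qed

lemma length_complement [simp]: "length (complement D) = length D"
  by (induction D rule: complement.induct) auto

text \<open>The crosses and the white cells of one drawing fill its columns, whose heights and depths are the exponents
  of a term.\<close>

lemma fits_complement_self:
  "admissible D \<Longrightarrow>
    \<exists>zs. fits zs D (complement D) \<and> distinct zs \<and> set zs = {- int (ncols YCol D) .. int (ncols XCol D)} - {0}"
proof (induction D rule: admissible.induct)
  case 1
  then show ?case by (auto simp: fits_def)
next
  case (2 a D)
  then obtain zs where zs: "fits zs D (complement D)" "distinct zs"
      "set zs = {- int (ncols YCol D) .. int (ncols XCol D)} - {0}" by auto
  let ?z = "int (Suc (ncols XCol D))"
  have "fits (?z # zs) ((XCol, a) # D) (complement ((XCol, a) # D))"
    using zs(1) 2(2) by (simp add: fits_Cons)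
  moreover have "set (?z # zs) = {- int (ncols YCol D) .. ?z} - {0}" "distinct (?z # zs)"
    unfolding list.set(2) distinct.simps(2) zs(3) using zs(2) by auto
  ultimately show ?case by (metis ncols_simps(2) coltype.distinct(1))
next
  case (3 b D)
  then obtain zs where zs: "fits zs D (complement D)" "distinct zs"
      "set zs = {- int (ncols YCol D) .. int (ncols XCol D)} - {0}" by auto
  let ?z = "- int (Suc (ncols YCol D))"
  have "fits (?z # zs) ((YCol, b) # D) (complement ((YCol, b) # D))"
    using zs(1) 3(2) by (simp add: fits_Cons)
  moreover have "set (?z # zs) = {?z .. int (ncols XCol D)} - {0}" "distinct (?z # zs)"
    unfolding list.set(2) distinct.simps(2) zs(3) using zs(2) by auto
  ultimately show ?case by (metis ncols_simps(2) coltype.distinct(1))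
qed

lemma length_admissible: "D \<in> admissible_drawings K L \<Longrightarrow> length D = K + L"
  using length_eq_ncols[of D] by (simp add: admissible_drawings_def)

lemma coefficient_imp_step:
  assumes "D \<in> admissible_drawings K L" "E \<in> admissible_drawings K L"
    and "Poly_Mapping.lookup (Delta (hook K L)) (exponents (cross_list D) + exponents (cross_list (complement E))) \<noteq> 0"
  shows "step (D, 0) (E, 0)"
proof -
  obtain zs where "fits zs D (complement E)" "distinct zs" "set zs = {- int K .. int L} - {0}"
    using assms(3) Delta_term_iff[of D K L "complement E"] assms(1,2) by (auto simp: length_admissible)
  then show ?thesis
    unfolding step_def using assms(1,2)
    by (intro exI[of _ zs] exI[of _ "int K"]) (simp add: length_admissible, simp add: admissible_drawings_def)
qed

lemma coefficient_diagonal: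
  assumes "D \<in> admissible_drawings K L"
  shows "Poly_Mapping.lookup (Delta (hook K L)) (exponents (cross_list D) + exponents (cross_list (complement D))) \<noteq> 0"
  using Delta_term_iff[of D K L "complement D"] fits_complement_self[of D] assms
  by (simp add: length_admissible) (simp add: admissible_drawings_def)

section \<open>Linear independence and conclusion\<close>

text \<open>Otherwise every drawing in \<open>S\<close> would have another one in \<open>S\<close> as predecessor, and passing to predecessors
  in the finite set \<open>S\<close> would eventually run around a cycle.\<close>

lemma admissible_steps_acyclic:
  assumes S: "finite S" "S \<noteq> {}" "S \<subseteq> admissible_drawings K L"
  shows "\<exists>E\<in>S. \<forall>D\<in>S. D \<noteq> E \<longrightarrow> \<not> step (D, 0) (E, 0)"
proof (rule ccontr)
  assume "\<not> ?thesis"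
  then obtain f where f: "\<And>E. E \<in> S \<Longrightarrow> f E \<in> S \<and> f E \<noteq> E \<and> step (f E, 0) (E, 0)"
    by metis
  obtain E0 where "E0 \<in> S" using S(2) by blast
  have inS: "(f ^^ k) E0 \<in> S" for k
    by (induction k) (use f \<open>E0 \<in> S\<close> in auto)
  have "\<not> inj (\<lambda>k. (f ^^ k) E0)"
  proof
    assume "inj (\<lambda>k. (f ^^ k) E0)"
    moreover have "finite (range (\<lambda>k. (f ^^ k) E0))"
      by (rule finite_subset[OF _ S(1)]) (use inS in auto)
    ultimately show False using finite_imageD infinite_UNIV_nat by blast
  qed
  then obtain i j where ij: "i < j" "(f ^^ i) E0 = (f ^^ j) E0"
    unfolding inj_def by (metis linorder_neqE_nat)
  define p where "p = j - i"
  define B where "B = (f ^^ i) E0"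
  have p: "0 < p" using ij by (simp add: p_def)
  have B: "(f ^^ p) B = B"
  proof -
    have "(f ^^ p) B = (f ^^ (p + i)) E0" by (simp add: B_def funpow_add)
    also have "p + i = j" using ij(1) by (simp add: p_def)
    finally show ?thesis using ij(2) by (simp add: B_def)
  qed
  have Bp: "(f ^^ (k * p)) B = B" for k
  proof (induction k)
    case (Suc k)
    then show ?case using B by (simp add: funpow_add)
  qed simp
  have Bmod: "(f ^^ (q + k * p)) B = (f ^^ q) B" for q k
    by (simp add: funpow_add Bp)
  \<comment> \<open>On the cycle through \<open>B\<close> the map \<open>f\<close> has period \<open>p\<close>, so its inverse is its power \<open>p - 1\<close>. Thus \<open>P\<close> runs through the cycle from predecessor to successor.\<close>
  define P where "P k = (f ^^ ((p - 1) * k)) B" for k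
  have PS: "P k \<in> S" for k
    using inS[of "(p - 1) * k + i"] by (simp add: P_def B_def funpow_add)
  have fP: "f (P (Suc k)) = P k" for k
  proof -
    have "f (P (Suc k)) = (f ^^ (Suc ((p - 1) * Suc k))) B" by (simp add: P_def)
    also have "Suc ((p - 1) * Suc k) = (p - 1) * k + 1 * p" using p by simp
    also have "(f ^^ \<dots>) B = P k" unfolding Bmod P_def ..
    finally show ?thesis .
  qed
  have "(P 1, 0 :: int) = (P 0, 0)"
  proof (rule closed_walk_constant[of p "\<lambda>k. (P k, 0)" "int K" "K + L" 1])
    fix k
    show "(P (k + p), 0 :: int) = (P k, 0)"
      using Bmod[of "(p - 1) * k" "p - 1"] by (simp add: P_def distrib_left)
    show "step (P k, 0) (P (Suc k), 0)"
      using f[OF PS[of "Suc k"]] fP[of k] by simp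
    have adm: "P k \<in> admissible_drawings K L" using PS S(3) by blast
    then show "length (fst (P k, 0 :: int)) = K + L" by (simp add: length_admissible)
    show "in_class (int K) (fst (P k, 0 :: int)) (snd (P k, 0))"
      using adm length_admissible[OF adm] by (simp add: in_class_def admissible_drawings_def)
  qed (rule p)
  then have "f (P 1) = P 1" using fP[of 0] by simp
  then show False using f[OF PS[of 1]] by simp
qed

text \<open>Take a drawing \<open>E\<close> in the support of a linear relation that no other drawing in the support leads to. At the
  monomial of its white cells only \<open>\<partial>\<^sub>E \<Delta>\<close> contributes.\<close>

lemma partial_drawings_independent:
  assumes "(\<Sum>D\<in>admissible_drawings K L. scale_poly (c D) (partial_drawing D (Delta (hook K L)))) = 0"
    and "D \<in> admissible_drawings K L"
  shows "c D = 0"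
proof (rule ccontr)
  assume "c D \<noteq> 0"
  let ?A = "admissible_drawings K L" and ?\<Delta> = "Delta (hook K L)"
  define S where "S = {D \<in> ?A. c D \<noteq> 0}"
  have fin: "finite ?A" using card_admissible_drawings by blast
  have S: "finite S" "S \<noteq> {}" "S \<subseteq> ?A"
    using fin assms(2) \<open>c D \<noteq> 0\<close> by (auto simp: S_def)
  obtain E where E: "E \<in> S" "\<And>D. D \<in> S \<Longrightarrow> D \<noteq> E \<Longrightarrow> \<not> step (D, 0) (E, 0)"
    using admissible_steps_acyclic[OF S] by blast
  let ?m = "exponents (cross_list (complement E))"
  have coeff: "factorials ?m * Poly_Mapping.lookup (partial_drawing D ?\<Delta>) ?m =
      factorials (exponents (cross_list D) + ?m) * Poly_Mapping.lookup ?\<Delta> (exponents (cross_list D) + ?m)" for D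
    unfolding partial_drawing_eq lookup_pderivs by (simp add: add.commute)
  have zero: "c D * Poly_Mapping.lookup (partial_drawing D ?\<Delta>) ?m = 0" if "D \<in> ?A" "D \<noteq> E" for D
  proof (cases "D \<in> S")
    case True
    then have "Poly_Mapping.lookup ?\<Delta> (exponents (cross_list D) + ?m) = 0"
      using E that S(3) coefficient_imp_step[of D K L E] by blast
    then show ?thesis using coeff[of D] by simp
  qed (use that in \<open>simp add: S_def\<close>)
  have "0 = (\<Sum>D\<in>?A. c D * Poly_Mapping.lookup (partial_drawing D ?\<Delta>) ?m)"
    using arg_cong[OF assms(1), of "\<lambda>p. Poly_Mapping.lookup p ?m"] by (simp add: lookup_sum lookup_scale_poly)
  also have "\<dots> = c E * Poly_Mapping.lookup (partial_drawing E ?\<Delta>) ?m +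
      (\<Sum>D\<in>?A - {E}. c D * Poly_Mapping.lookup (partial_drawing D ?\<Delta>) ?m)"
    using E(1) S(3) by (intro sum.remove[OF fin]) blast
  also have "(\<Sum>D\<in>?A - {E}. c D * Poly_Mapping.lookup (partial_drawing D ?\<Delta>) ?m) = 0"
    using zero by (intro sum.neutral) blast
  finally have "c E * Poly_Mapping.lookup (partial_drawing E ?\<Delta>) ?m = 0"
    unfolding add_0_right by (rule sym)
  moreover have "Poly_Mapping.lookup (partial_drawing E ?\<Delta>) ?m \<noteq> 0"
    using coeff[of E] coefficient_diagonal[of E K L] E(1) S(3) by auto
  ultimately show False using E(1) by (simp add: S_def)
qed

lemma independent_family_image:
  assumes fin: "finite A"
    and indep: "\<And>c x. (\<Sum>x\<in>A. scale_poly (c x) (g x)) = 0 \<Longrightarrow> x \<in> A \<Longrightarrow> c x = 0"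
  shows "inj_on g A" "poly_xy.independent (g ` A)"
proof -
  show inj: "inj_on g A"
  proof (rule inj_onI, rule ccontr)
    fix x y assume xy: "x \<in> A" "y \<in> A" "g x = g y" "x \<noteq> y"
    let ?c = "\<lambda>z. if z = x then 1 else if z = y then -1 else 0"
    have "(\<Sum>z\<in>A. scale_poly (?c z) (g z)) = (\<Sum>z\<in>{x, y}. scale_poly (?c z) (g z))"
      using xy fin by (intro sum.mono_neutral_right) auto
    also have "\<dots> = 0" using xy by simp
    finally show False using indep[of ?c x] xy(1) by simp
  qed
  show "poly_xy.independent (g ` A)"
  proof (rule poly_xy.independent_if_scalars_zero)
    fix f p assume *: "(\<Sum>p\<in>g ` A. scale_poly (f p) p) = 0" "p \<in> g ` A"
    then have "(\<Sum>x\<in>A. scale_poly (f (g x)) (g x)) = 0"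
      by (simp add: sum.reindex[OF inj])
    then show "f p = 0" using indep[of "\<lambda>x. f (g x)"] *(2) by auto
  qed (use fin in simp)
qed

lemma independent_spans:
  assumes "finite C" "poly_xy.independent B" "B \<subseteq> poly_xy.span C" "card C \<le> card B"
  shows "poly_xy.span C \<subseteq> poly_xy.span B"
proof (rule subsetI, rule ccontr)
  fix p assume p: "p \<in> poly_xy.span C" "p \<notin> poly_xy.span B"
  have "finite B"
    using poly_xy.independent_span_bound[OF assms(1-3)] by blast
  have "poly_xy.independent (insert p B)"
    using p(2) assms(2) by (rule poly_xy.independent_insertI)
  then have "card (insert p B) \<le> card C"
    using poly_xy.independent_span_bound[OF assms(1), of "insert p B"] assms(3) p(1) by blast
  moreover have "p \<notin> B" using p(2) poly_xy.span_base by blast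
  ultimately show False using \<open>finite B\<close> assms(4) by simp
qed

theorem theorem1:
  fixes K L :: nat
  shows "poly_xy.span {partial_drawing D (Delta (hook K L)) | D. D \<in> drawings K L} = M (hook K L)"
proof
  let ?\<Delta> = "Delta (hook K L)"
  let ?g = "\<lambda>D. partial_drawing D ?\<Delta>"
  let ?A = "admissible_drawings K L"
  let ?C = "{Delta_deriv K L u | u. straight K L u}"
  have mem: "?g D \<in> M (hook K L)" if "D \<in> drawings K L" for D
  proof -
    have "set (cross_list D) \<subseteq> vars (sum_list (hook K L))"
      using that by (auto simp: cross_list_def drawings_def place_var_def vars_def sum_list_hook split: coltype.splits)
    then show ?thesis
      unfolding M_def partial_drawing_eq by (intro poly_xy.span_base) blast
  qed
  show "poly_xy.span {?g D | D. D \<in> drawings K L} \<subseteq> M (hook K L)"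
    by (rule poly_xy.span_minimal) (use mem in \<open>auto simp: M_def\<close>)
  have A: "finite ?A" "card ?A = fact (K + L + 1)" using card_admissible_drawings by blast+
  have inj: "inj_on ?g ?A" and indep: "poly_xy.independent (?g ` ?A)"
    using independent_family_image[OF A(1), of ?g] partial_drawings_independent by blast+
  have sub: "?g ` ?A \<subseteq> {?g D | D. D \<in> drawings K L}" using admissible_drawings_subset by blast
  have "poly_xy.span ?C \<subseteq> poly_xy.span (?g ` ?A)"
  proof (rule independent_spans[OF card_straight_derivs(1) indep])
    show "?g ` ?A \<subseteq> poly_xy.span ?C"
      using mem admissible_drawings_subset M_hook_subset_span by blast
    show "card ?C \<le> card (?g ` ?A)"
      using card_straight_derivs(2) card_image[OF inj] A(2) by simp
  qed
  also have "\<dots> \<subseteq> poly_xy.span {?g D | D. D \<in> drawings K L}"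
    by (rule poly_xy.span_mono[OF sub])
  finally show "M (hook K L) \<subseteq> poly_xy.span {?g D | D. D \<in> drawings K L}"
    using M_hook_subset_span by blast
qed

end
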